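(* Let $\Omega\subset\mathbb{R}^N$ be a bounded open set, $\sigma>0$, $h:[0,\sigma)\to\mathbb{R}^+$ continuous, strictly increasing with $\lim_{s\to\sigma^-}h(s)=+\infty$, and suppose there exists $\gamma\in[1,2)$ with $\lim_{s\to\sigma^-}(\sigma-s)^\gamma h(s)=C>0$. Let $f\in L^p(\Omega)$, $p>N/2$, with $f\ge\rho$ in $\Omega$ for some $\rho>0$. Let $H(s)=\int_0^s h$, $\psi(s)=\int_0^s e^{-H(t)}dt$, $L=\psi(\sigma)$, and $g(s)=e^{-H(\psi^{-1}(s))}$ on $[0,L]$ ($g(L)=0$). Then for every $\lambda>0$ there exists a unique $v_\lambda\in H^1_0(\Omega)$ with $0\le v_\lambda\le L$ a.e. solving $$-\Delta v=\lambda f\,g(v)\text{ in }\Omega,\qquad v=0\text{ on }\partial\Omega,$$ i.e. $\int_\Omega\nabla v_\lambda\cdot\nabla\varphi=\lambda\int_\Omega f\,g(v_\lambda)\varphi$ for all $\varphi\in H^1_0(\Omega)$. *)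

theory Defs
  imports "HOL-Analysis.Analysis"
begin

definition C1c_test :: "'a::euclidean_space set \<Rightarrow> ('a \<Rightarrow> real) \<Rightarrow> ('a \<Rightarrow> 'a) \<Rightarrow> bool" where
  "C1c_test \<Omega> \<phi> D \<longleftrightarrow>
     (\<forall>x. (\<phi> has_derivative (\<lambda>y. D x \<bullet> y)) (at x)) \<and> continuous_on UNIV D \<and>
     compact (closure {x. \<phi> x \<noteq> 0}) \<and> closure {x. \<phi> x \<noteq> 0} \<subseteq> \<Omega>"

definition L2_on :: "'a::euclidean_space set \<Rightarrow> ('a \<Rightarrow> real) \<Rightarrow> bool" where
  "L2_on \<Omega> u \<longleftrightarrow> u \<in> borel_measurable (lebesgue_on \<Omega>) \<and>
     integrable (lebesgue_on \<Omega>) (\<lambda>x. (u x)\<^sup>2)"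

definition L2_vec_on :: "'a::euclidean_space set \<Rightarrow> ('a \<Rightarrow> 'a) \<Rightarrow> bool" where
  "L2_vec_on \<Omega> G \<longleftrightarrow> G \<in> borel_measurable (lebesgue_on \<Omega>) \<and>
     integrable (lebesgue_on \<Omega>) (\<lambda>x. (norm (G x))\<^sup>2)"

definition Lp_on :: "'a::euclidean_space set \<Rightarrow> real \<Rightarrow> ('a \<Rightarrow> real) \<Rightarrow> bool" where
  "Lp_on \<Omega> p u \<longleftrightarrow> u \<in> borel_measurable (lebesgue_on \<Omega>) \<and>
     integrable (lebesgue_on \<Omega>) (\<lambda>x. \<bar>u x\<bar> powr p)"

text \<open>H^1_0(Omega): closure of compactly supported test functions in the H^1 norm.
  H10 Omega v G means v \<in> H^1_0(Omega) with (weak) gradient G.\<close>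
definition H10 :: "'a::euclidean_space set \<Rightarrow> ('a \<Rightarrow> real) \<Rightarrow> ('a \<Rightarrow> 'a) \<Rightarrow> bool" where
  "H10 \<Omega> v G \<longleftrightarrow> L2_on \<Omega> v \<and> L2_vec_on \<Omega> G \<and>
     (\<exists>\<phi> D. (\<forall>k. C1c_test \<Omega> (\<phi> k) (D k)) \<and>
        (\<lambda>k. LINT x|lebesgue_on \<Omega>. (\<phi> k x - v x)\<^sup>2) \<longlonglongrightarrow> 0 \<and>
        (\<lambda>k. LINT x|lebesgue_on \<Omega>. (norm (D k x - G x))\<^sup>2) \<longlonglongrightarrow> 0)"

definition Hf :: "(real \<Rightarrow> real) \<Rightarrow> real \<Rightarrow> real" where
  "Hf h s = integral {0..s} h"

definition psi :: "(real \<Rightarrow> real) \<Rightarrow> real \<Rightarrow> real" where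
  "psi h s = integral {0..s} (\<lambda>t. exp (- Hf h t))"

definition Lval :: "(real \<Rightarrow> real) \<Rightarrow> real \<Rightarrow> real" where
  "Lval h \<sigma> = integral {0..<\<sigma>} (\<lambda>t. exp (- Hf h t))"

definition gf :: "(real \<Rightarrow> real) \<Rightarrow> real \<Rightarrow> real \<Rightarrow> real" where
  "gf h \<sigma> s = (if s < Lval h \<sigma> then exp (- Hf h (the_inv_into {0..<\<sigma>} (psi h) s)) else 0)"

end

theory Submission
  imports Defs
begin

text \<open>
  Write \<open>g\<close> for the nonlinearity, extended by \<open>g 0 = 1\<close> to the left of \<open>0\<close>. It is continuous
  (\<open>H\<close> diverges at \<open>\<sigma>\<close> because \<open>\<gamma> \<ge> 1\<close>), antitone and vanishes beyond \<open>L\<close>, so \<open>-g\<close> has a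
  nonnegative convex potential \<open>F\<close>. The strictly convex energy
  \<open>1/2 \<integral> |\<nabla>v|\<^sup>2 + \<lambda> \<integral> f F(v)\<close> is minimised over test functions; the parallelogram law and the
  Poincare inequality make minimising sequences converge in \<open>H\<^sup>1\<^sub>0\<close>, and the limit solves the equation
  against test functions. Testing with smoothed absolute values bounds \<open>\<lambda> \<integral> f g(v) |\<psi>|\<close> by
  \<open>\<parallel>\<nabla>v\<parallel> \<parallel>\<nabla>\<psi>\<parallel>\<close>, which extends the equation to all of \<open>H\<^sup>1\<^sub>0\<close> knowing only that \<open>f\<close> is integrable.
  The bounds \<open>0 \<le> v \<le> L\<close> come from testing with \<open>C\<^sup>1\<close> truncations of \<open>v\<close>, and uniqueness from
  testing the difference of two solutions with itself, as \<open>g\<close> is antitone.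
\<close>

section \<open>Square-integrable functions\<close>

text \<open>The energy is minimised over test functions because these are bounded: \<open>f\<close>
  is merely integrable, so \<open>f * F(v)\<close> may fail to be integrable for a general
  \<open>v\<close> in \<open>H10\<close>. The limit \<open>v\<close> is therefore never inserted
  into the energy; only its approximations are, and \<open>v\<close> appears after passing to the
  limit in inequalities between integrals with bounded factors. The same obstacle returns when the
  equation is extended: the product of \<open>f * g(v)\<close> with an unbounded function is not
  integrable a priori, and it is the equation itself that provides the missing bound. Convexity of
  \<open>F\<close> enters only as a subgradient inequality. It yields midpoint convexity, hence the
  Cauchy property, and a one-sided Euler-Lagrange inequality, so \<open>F\<close> is never
  differentiated. In \<open>H10\<close> the gradient is a separate function pinned down by an
  approximating sequence. Differences and substitutions are handled by acting on that sequence,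
  which is why truncations have to be C1: they must map test functions to test functions.\<close>

definition square_integrable :: "'x measure \<Rightarrow> ('x \<Rightarrow> 'b::euclidean_space) \<Rightarrow> bool" where
  "square_integrable M u \<longleftrightarrow> u \<in> borel_measurable M \<and> integrable M (\<lambda>x. (norm (u x))\<^sup>2)"

text \<open>The norm is kept squared because it is then a quadratic polynomial along lines
  \<open>u + t v\<close>; the discriminant and energy arguments read off its coefficients. Values in
  any Euclidean space cover functions and gradients at once.\<close>

definition sq_norm :: "'x measure \<Rightarrow> ('x \<Rightarrow> 'b::euclidean_space) \<Rightarrow> real" where
  "sq_norm M u = (LINT x|M. (norm (u x))\<^sup>2)"

lemma square_integrableD:
  assumes "square_integrable M u"
  shows "u \<in> borel_measurable M" "integrable M (\<lambda>x. (norm (u x))\<^sup>2)"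
  using assms by (auto simp: square_integrable_def)

lemma sq_norm_nonneg: "0 \<le> sq_norm M u"
  by (simp add: sq_norm_def)

lemma norm_add_square_le:
  fixes a b :: "'b::real_normed_vector"
  shows "(norm (a + b))\<^sup>2 \<le> 2 * (norm a)\<^sup>2 + 2 * (norm b)\<^sup>2"
proof -
  have "(norm (a + b))\<^sup>2 \<le> (norm a + norm b)\<^sup>2"
    by (intro power_mono norm_triangle_ineq) auto
  also have "\<dots> \<le> 2 * (norm a)\<^sup>2 + 2 * (norm b)\<^sup>2"
    using sum_squares_bound[of "norm a" "norm b"] by (simp add: power2_sum)
  finally show ?thesis .
qed

lemma square_integrable_add:
  assumes "square_integrable M u" "square_integrable M v"
  shows "square_integrable M (\<lambda>x. u x + v x)"
proof -
  note [measurable] = square_integrableD(1)[OF assms(1)] square_integrableD(1)[OF assms(2)]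
  have "integrable M (\<lambda>x. 2 * (norm (u x))\<^sup>2 + 2 * (norm (v x))\<^sup>2)"
    using assms by (auto simp: square_integrable_def)
  then have "integrable M (\<lambda>x. (norm (u x + v x))\<^sup>2)"
    by (rule Bochner_Integration.integrable_bound) (auto simp: norm_add_square_le)
  then show ?thesis by (simp add: square_integrable_def)
qed

lemma square_integrable_scaleR:
  assumes "square_integrable M u"
  shows "square_integrable M (\<lambda>x. c *\<^sub>R u x)"
  using assms by (auto simp: square_integrable_def power_mult_distrib)

lemma square_integrable_diff:
  assumes "square_integrable M u" "square_integrable M v"
  shows "square_integrable M (\<lambda>x. u x - v x)"
  using square_integrable_add[OF assms(1) square_integrable_scaleR[OF assms(2), of "-1"]] by simp

lemma sq_norm_add_le:
  assumes "square_integrable M u" "square_integrable M v"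
  shows "sq_norm M (\<lambda>x. u x + v x) \<le> 2 * sq_norm M u + 2 * sq_norm M v"
proof -
  have "sq_norm M (\<lambda>x. u x + v x) \<le> (LINT x|M. 2 * (norm (u x))\<^sup>2 + 2 * (norm (v x))\<^sup>2)"
    unfolding sq_norm_def using square_integrable_add[OF assms] assms
    by (intro integral_mono) (auto simp: square_integrable_def norm_add_square_le)
  also have "\<dots> = 2 * sq_norm M u + 2 * sq_norm M v"
    unfolding sq_norm_def using assms by (simp add: square_integrable_def)
  finally show ?thesis .
qed

lemma sq_norm_scaleR: "sq_norm M (\<lambda>x. c *\<^sub>R u x) = c\<^sup>2 * sq_norm M u"
  by (simp add: sq_norm_def power_mult_distrib)

lemma sq_norm_diff_le:
  assumes "square_integrable M u" "square_integrable M v"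
  shows "sq_norm M (\<lambda>x. u x - v x) \<le> 2 * sq_norm M u + 2 * sq_norm M v"
  using sq_norm_add_le[OF assms(1) square_integrable_scaleR[OF assms(2), of "-1"]]
  by (simp add: sq_norm_scaleR[of M "-1" v, simplified])

lemma square_integrable_inner:
  assumes "square_integrable M u" "square_integrable M v"
  shows "integrable M (\<lambda>x. u x \<bullet> v x)"
proof -
  note [measurable] = square_integrableD(1)[OF assms(1)] square_integrableD(1)[OF assms(2)]
  have "integrable M (\<lambda>x. (norm (u x))\<^sup>2 + (norm (v x))\<^sup>2)"
    using assms by (auto simp: square_integrable_def)
  then show ?thesis
  proof (rule Bochner_Integration.integrable_bound)
    show "AE x in M. norm (u x \<bullet> v x) \<le> norm ((norm (u x))\<^sup>2 + (norm (v x))\<^sup>2)"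
    proof (rule AE_I2)
      fix x
      show "norm (u x \<bullet> v x) \<le> norm ((norm (u x))\<^sup>2 + (norm (v x))\<^sup>2)"
        using Cauchy_Schwarz_ineq2[of "u x" "v x"] sum_squares_bound[of "norm (u x)" "norm (v x)"]
        by (auto intro: order_trans[OF Cauchy_Schwarz_ineq2])
    qed
  qed simp
qed

lemma sq_norm_add_scaleR:
  assumes "square_integrable M u" "square_integrable M v"
  shows "sq_norm M (\<lambda>x. u x + t *\<^sub>R v x)
    = sq_norm M u + 2 * t * (LINT x|M. u x \<bullet> v x) + t\<^sup>2 * sq_norm M v"
proof -
  have "(norm (u x + t *\<^sub>R v x))\<^sup>2 = (norm (u x))\<^sup>2 + 2 * t * (u x \<bullet> v x) + t\<^sup>2 * (norm (v x))\<^sup>2" for x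
    unfolding power2_norm_eq_inner
    by (simp add: inner_add inner_commute power2_eq_square algebra_simps)
  then show ?thesis
    using assms square_integrable_inner[OF assms] by (simp add: sq_norm_def square_integrable_def)
qed

text \<open>The squared norm of \<open>u + t v\<close> is a nonnegative quadratic in
  \<open>t\<close>; evaluating it at its vertex \<open>- ?B / ?C\<close> gives the inequality. If
  \<open>?C = 0\<close> it is affine and would take the value -1 at the chosen \<open>t\<close>
  unless \<open>?B = 0\<close>.\<close>

lemma Cauchy_Schwarz_sq_norm:
  assumes "square_integrable M u" "square_integrable M v"
  shows "(LINT x|M. u x \<bullet> v x)\<^sup>2 \<le> sq_norm M u * sq_norm M v"
proof -
  let ?A = "sq_norm M u" and ?B = "LINT x|M. u x \<bullet> v x" and ?C = "sq_norm M v"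
  have q: "0 \<le> ?A + 2 * t * ?B + t\<^sup>2 * ?C" for t
    using sq_norm_nonneg[of M "\<lambda>x. u x + t *\<^sub>R v x"] sq_norm_add_scaleR[OF assms, of t] by simp
  show ?thesis
  proof (cases "?C = 0")
    case True
    have "?B = 0"
    proof (rule ccontr)
      assume "?B \<noteq> 0"
      then show False using q[of "- (?A + 1) / (2 * ?B)"] True by (simp add: field_simps)
    qed
    then show ?thesis using True by simp
  next
    case False
    then have "?C > 0" using sq_norm_nonneg[of M v] by simp
    then have "?A + 2 * (- ?B / ?C) * ?B + (- ?B / ?C)\<^sup>2 * ?C = ?A - ?B\<^sup>2 / ?C"
      by (simp add: field_simps power2_eq_square)
    then have "?B\<^sup>2 / ?C \<le> ?A" using q[of "- ?B / ?C"] by simp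
    then show ?thesis using \<open>?C > 0\<close> by (simp add: field_simps)
  qed
qed

lemma abs_integral_inner_le:
  assumes "square_integrable M u" "square_integrable M v"
  shows "\<bar>LINT x|M. u x \<bullet> v x\<bar> \<le> sqrt (sq_norm M u) * sqrt (sq_norm M v)"
  using real_sqrt_le_mono[OF Cauchy_Schwarz_sq_norm[OF assms]] by (simp add: real_sqrt_mult)

lemma tendsto_integral_inner:
  assumes "square_integrable M u" "\<And>k::nat. square_integrable M (v k)" "square_integrable M w"
    and lim: "(\<lambda>k. sq_norm M (\<lambda>x. v k x - w x)) \<longlonglongrightarrow> 0"
  shows "(\<lambda>k. LINT x|M. u x \<bullet> v k x) \<longlonglongrightarrow> (LINT x|M. u x \<bullet> w x)"
proof -
  have "(\<lambda>k. sqrt (sq_norm M u) * sqrt (sq_norm M (\<lambda>x. v k x - w x))) \<longlonglongrightarrow> sqrt (sq_norm M u) * sqrt 0"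
    by (intro tendsto_intros lim)
  then have "(\<lambda>k. sqrt (sq_norm M u) * sqrt (sq_norm M (\<lambda>x. v k x - w x))) \<longlonglongrightarrow> 0" by simp
  then have "(\<lambda>k. (LINT x|M. u x \<bullet> v k x) - (LINT x|M. u x \<bullet> w x)) \<longlonglongrightarrow> 0"
  proof (rule Lim_null_comparison[OF always_eventually, rotated], intro allI)
    fix k
    show "norm ((LINT x|M. u x \<bullet> v k x) - (LINT x|M. u x \<bullet> w x))
      \<le> sqrt (sq_norm M u) * sqrt (sq_norm M (\<lambda>x. v k x - w x))"
    using abs_integral_inner_le[OF assms(1) square_integrable_diff[OF assms(2,3)]]
      square_integrable_inner[OF assms(1,2)] square_integrable_inner[OF assms(1,3)]
    by (simp add: inner_diff_right)
  qed
  then show ?thesis by (simp add: LIM_zero_iff)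
qed

text \<open>Fatou's lemma with a convergent sequence of bounds instead of a fixed one. It delivers
  integrability of the limit together with the sharp bound \<open>C\<close> where no dominating
  function is available.\<close>

lemma Fatou_integrable:
  fixes u :: "nat \<Rightarrow> 'x \<Rightarrow> real"
  assumes int: "\<And>j. integrable M (u j)" and nonneg: "\<And>j. AE x in M. 0 \<le> u j x"
    and [measurable]: "v \<in> borel_measurable M"
    and lim: "AE x in M. (\<lambda>j. u j x) \<longlonglongrightarrow> v x"
    and bound: "\<And>j. integral\<^sup>L M (u j) \<le> c j" and c: "c \<longlonglongrightarrow> C"
  shows "integrable M v" "integral\<^sup>L M v \<le> C"
proof -
  have [measurable]: "u j \<in> borel_measurable M" for j using int by auto
  have nonneg': "AE x in M. \<forall>j. 0 \<le> u j x" using nonneg by (simp add: AE_all_countable)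
  have vnn: "AE x in M. 0 \<le> v x"
    using nonneg' lim by eventually_elim (auto intro: LIMSEQ_le_const)
  have "0 \<le> c j" for j
    using bound[of j] integral_nonneg_AE[OF nonneg[of j]] by linarith
  then have C0: "0 \<le> C" using c by (auto intro: LIMSEQ_le_const)
  have "(\<integral>\<^sup>+x. ennreal (v x) \<partial>M) = (\<integral>\<^sup>+x. liminf (\<lambda>j. ennreal (u j x)) \<partial>M)"
    using lim
    by (intro nn_integral_cong_AE, eventually_elim)
       (metis lim_imp_Liminf tendsto_ennrealI trivial_limit_sequentially)
  also have "\<dots> \<le> liminf (\<lambda>j. \<integral>\<^sup>+x. ennreal (u j x) \<partial>M)"
    by (rule nn_integral_liminf) simp
  also have "\<dots> \<le> liminf (\<lambda>j. ennreal (c j))"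
    using bound by (intro Liminf_mono always_eventually allI)
      (simp add: nn_integral_eq_integral[OF int nonneg] ennreal_leI)
  also have "\<dots> = ennreal C"
    using c by (intro lim_imp_Liminf tendsto_ennrealI) auto
  finally have le: "(\<integral>\<^sup>+x. ennreal (v x) \<partial>M) \<le> ennreal C" .
  show iv: "integrable M v"
    using le vnn by (intro integrableI_nonneg) (auto simp: order.strict_iff_order top_unique)
  show "integral\<^sup>L M v \<le> C"
    using le C0 by (simp add: nn_integral_eq_integral[OF iv vnn])
qed

section \<open>Almost everywhere convergent subsequences and completeness of L2\<close>

lemma AE_subseq_of_sq_norm:
  assumes "\<And>k::nat. square_integrable M (u k)" "square_integrable M v"
    and "(\<lambda>k. sq_norm M (\<lambda>x. u k x - v x)) \<longlonglongrightarrow> 0"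
  obtains r where "strict_mono r" "AE x in M. (\<lambda>k. u (r k) x) \<longlonglongrightarrow> v x"
proof -
  have "integrable M (\<lambda>x. (norm (u k x - v x))\<^sup>2)" for k
    using square_integrable_diff[OF assms(1,2)] by (simp add: square_integrable_def)
  moreover have "(\<lambda>k. LINT x|M. norm ((norm (u k x - v x))\<^sup>2)) \<longlonglongrightarrow> 0"
    using assms(3) by (simp add: sq_norm_def)
  ultimately obtain r where r: "strict_mono r"
    "AE x in M. (\<lambda>k. (norm (u (r k) x - v x))\<^sup>2) \<longlonglongrightarrow> 0"
    using tendsto_L1_AE_subseq[of M "\<lambda>k x. (norm (u k x - v x))\<^sup>2"] by auto
  have "AE x in M. (\<lambda>k. u (r k) x) \<longlonglongrightarrow> v x"
    using r(2)
  proof eventually_elim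
    case (elim x)
    from tendsto_real_sqrt[OF elim] have "(\<lambda>k. norm (u (r k) x - v x)) \<longlonglongrightarrow> 0" by simp
    then show ?case by (simp add: LIM_zero_iff tendsto_norm_zero_iff)
  qed
  then show thesis using r(1) that by blast
qed

text \<open>Along a subsequence with increments \<open>d k\<close> of squared norm at most \<open>2 / 8 ^ k\<close>, the bound
  \<open>2 |d k| \<le> 2 ^ k |d k| ^ 2 + 1 / 2 ^ k\<close> gives absolute convergence almost everywhere.\<close>

lemma L2_complete:
  fixes u :: "nat \<Rightarrow> 'x \<Rightarrow> 'b::euclidean_space"
  assumes u: "\<And>k. square_integrable M (u k)"
    and cauchy: "\<And>j k. sq_norm M (\<lambda>x. u j x - u k x) \<le> a j + a k"
    and a: "a \<longlonglongrightarrow> (0::real)"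
  obtains v where "square_integrable M v" "(\<lambda>k. sq_norm M (\<lambda>x. u k x - v x)) \<longlonglongrightarrow> 0"
proof -
  note [measurable] = square_integrableD(1)[OF u]
  have "\<exists>N. a N \<le> (1/8)^n" for n :: nat
  proof -
    have "\<forall>\<^sub>F N in sequentially. a N < (1/8)^n" using a by (rule order_tendstoD) simp
    then show ?thesis by (auto simp: eventually_sequentially intro: less_imp_le)
  qed
  then obtain r where r: "a (r n) \<le> (1/8)^n" for n by metis
  have a0: "0 \<le> a k" for k
    using cauchy[of k k] sq_norm_nonneg[of M "\<lambda>x. u k x - u k x"] by simp
  define d where "d n x = u (r (Suc n)) x - u (r n) x" for n x
  have d: "square_integrable M (d n)" for n
    unfolding d_def by (intro square_integrable_diff u)
  note [measurable] = square_integrableD(1)[OF d]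
  have dn: "sq_norm M (d n) \<le> 2 * (1/8)^n" for n
  proof -
    have "sq_norm M (d n) \<le> a (r (Suc n)) + a (r n)" unfolding d_def by (rule cauchy)
    also have "\<dots> \<le> (1/8)^Suc n + (1/8)^n" by (intro add_mono r)
    also have "\<dots> \<le> 2 * (1/8)^n" by simp
    finally show ?thesis .
  qed
  have "AE x in M. summable (\<lambda>n. 2^n * (norm (d n x))\<^sup>2)"
  proof -
    have "(\<integral>\<^sup>+x. (\<Sum>n. ennreal (2^n * (norm (d n x))\<^sup>2)) \<partial>M)
        = (\<Sum>n. \<integral>\<^sup>+x. ennreal (2^n * (norm (d n x))\<^sup>2) \<partial>M)"
      by (rule nn_integral_suminf) simp
    also have "\<dots> = (\<Sum>n. ennreal (2^n * sq_norm M (d n)))"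
      unfolding sq_norm_def
      by (subst nn_integral_eq_integral) (auto simp: square_integrableD(2)[OF d])
    also have "\<dots> \<le> (\<Sum>n. ennreal (2 * (1/4)^n))"
    proof (intro suminf_le ennreal_leI)
      fix n
      have "2^n * sq_norm M (d n) \<le> 2^n * (2 * (1/8)^n)" by (intro mult_left_mono dn) simp
      also have "\<dots> = 2 * (1/4)^n" by (simp add: power_divide power_mult_distrib[symmetric] field_simps)
      finally show "2^n * sq_norm M (d n) \<le> 2 * (1/4)^n" .
    qed auto
    also have "\<dots> = ennreal (\<Sum>n. 2 * (1/4)^n)"
      by (rule suminf_ennreal2) (auto intro!: summable_mult summable_geometric)
    finally have "(\<integral>\<^sup>+x. (\<Sum>n. ennreal (2^n * (norm (d n x))\<^sup>2)) \<partial>M) \<noteq> \<infinity>"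
      by (auto simp: top_unique)
    then have "AE x in M. (\<Sum>n. ennreal (2^n * (norm (d n x))\<^sup>2)) \<noteq> \<infinity>"
      by (intro nn_integral_noteq_infinite) simp_all
    then show ?thesis
      by eventually_elim (rule summable_suminf_not_top, auto)
  qed
  then have "AE x in M. convergent (\<lambda>n. u (r n) x)"
  proof eventually_elim
    case (elim x)
    have "summable (\<lambda>n. 2^n * (norm (d n x))\<^sup>2 + (1/2)^n)"
      by (intro summable_add elim summable_geometric) simp
    then have "summable (\<lambda>n. norm (d n x))"
    proof (rule summable_comparison_test_ev[rotated], intro always_eventually allI)
      fix n
      have "2 * norm (d n x) \<le> 2^n * (norm (d n x))\<^sup>2 + (1/2)^n"
      proof -
        \<comment> \<open>Expanding this square gives the announced bound; the powers
          \<open>(2 * (1/2))^n\<close> are kept visible because they collapse to 1.\<close>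
        have "0 \<le> 2^n * (norm (d n x) - (1/2)^n)\<^sup>2" by simp
        also have "\<dots> = 2^n * (norm (d n x))\<^sup>2 - 2 * norm (d n x) * (2 * (1/2))^n + (1/2)^n * (2 * (1/2))^n"
          unfolding power_mult_distrib by (simp add: power2_eq_square algebra_simps)
        finally show ?thesis by simp
      qed
      then show "norm (norm (d n x)) \<le> 2^n * (norm (d n x))\<^sup>2 + (1/2)^n"
        using norm_ge_zero[of "d n x"] by (simp del: norm_ge_zero)
    qed
    then have "summable (\<lambda>n. d n x)" by (rule summable_norm_cancel)
    then have "convergent (\<lambda>n. \<Sum>i<n. d i x)" by (simp add: summable_iff_convergent)
    then have "convergent (\<lambda>n. (\<Sum>i<n. d i x) + u (r 0) x)"
      by (intro convergent_add convergent_const)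
    moreover have "(\<Sum>i<n. d i x) + u (r 0) x = u (r n) x" for n
      unfolding d_def by (induction n) (auto simp: algebra_simps)
    ultimately show ?case by simp
  qed
  then have lim: "AE x in M. (\<lambda>n. u (r n) x) \<longlonglongrightarrow> lim (\<lambda>n. u (r n) x)"
    by (simp add: convergent_LIMSEQ_iff)
  define v where "v x = lim (\<lambda>n. u (r n) x)" for x
  have [measurable]: "v \<in> borel_measurable M" unfolding v_def by (intro borel_measurable_lim_metric) simp
  have ar: "(\<lambda>j. a k + a (r j)) \<longlonglongrightarrow> a k" for k
  proof -
    have "(\<lambda>n. a (r n)) \<longlonglongrightarrow> 0"
      by (rule Lim_null_comparison[where g = "\<lambda>n. (1/8)^n"]) (auto simp: a0 r intro: LIMSEQ_power_zero)
    then have "(\<lambda>j. a k + a (r j)) \<longlonglongrightarrow> a k + 0" by (intro tendsto_intros)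
    then show ?thesis by simp
  qed
  \<comment> \<open>Fatou in \<open>j\<close>, with \<open>k\<close> fixed, turns the Cauchy
    estimate into a bound on the distance from \<open>u k\<close> to the limit. The subsequence
    serves only to construct \<open>v\<close>; the whole sequence converges.\<close>
  have fat: "integrable M (\<lambda>x. (norm (u k x - v x))\<^sup>2) \<and> sq_norm M (\<lambda>x. u k x - v x) \<le> a k" for k
  proof -
    have "AE x in M. (\<lambda>j. (norm (u k x - u (r j) x))\<^sup>2) \<longlonglongrightarrow> (norm (u k x - v x))\<^sup>2"
      using lim unfolding v_def[symmetric] by eventually_elim (intro tendsto_intros)
    note F = Fatou_integrable[where u = "\<lambda>j x. (norm (u k x - u (r j) x))\<^sup>2" and M = M
        and v = "\<lambda>x. (norm (u k x - v x))\<^sup>2", OF _ _ _ this _ ar[of k]]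
    show ?thesis
      unfolding sq_norm_def
      using cauchy[of k] square_integrableD(2)[OF square_integrable_diff[OF u u]]
      by (intro conjI F) (auto simp: sq_norm_def)
  qed
  have dv: "square_integrable M (\<lambda>x. u k x - v x)" for k
    using fat by (simp add: square_integrable_def)
  have "square_integrable M v"
    using square_integrable_diff[OF u[of 0] dv[of 0]] by simp
  moreover have "(\<lambda>k. sq_norm M (\<lambda>x. u k x - v x)) \<longlonglongrightarrow> 0"
    by (rule Lim_null_comparison[OF _ a]) (auto simp: fat sq_norm_nonneg)
  ultimately show thesis using that by blast
qed

section \<open>Test functions and H10\<close>

lemma tendsto_one_over_Suc: "(\<lambda>k. 1 / real (Suc k)) \<longlonglongrightarrow> 0"
  using LIMSEQ_inverse_real_of_nat by (simp only: inverse_eq_divide)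


lemma L2_on_iff: "L2_on \<Omega> u \<longleftrightarrow> square_integrable (lebesgue_on \<Omega>) u"
  by (simp add: L2_on_def square_integrable_def)

lemma L2_vec_on_iff: "L2_vec_on \<Omega> G \<longleftrightarrow> square_integrable (lebesgue_on \<Omega>) G"
  by (simp add: L2_vec_on_def square_integrable_def)

lemma H10_iff:
  "H10 \<Omega> v G \<longleftrightarrow> square_integrable (lebesgue_on \<Omega>) v \<and> square_integrable (lebesgue_on \<Omega>) G \<and>
    (\<exists>\<phi> D. (\<forall>k. C1c_test \<Omega> (\<phi> k) (D k)) \<and>
      (\<lambda>k. sq_norm (lebesgue_on \<Omega>) (\<lambda>x. \<phi> k x - v x)) \<longlonglongrightarrow> 0 \<and>
      (\<lambda>k. sq_norm (lebesgue_on \<Omega>) (\<lambda>x. D k x - G x)) \<longlonglongrightarrow> 0)"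
  by (simp add: H10_def L2_on_iff L2_vec_on_iff sq_norm_def)

lemma C1c_testD:
  assumes "C1c_test \<Omega> \<phi> D"
  shows "(\<phi> has_derivative (\<lambda>y. D x \<bullet> y)) (at x)" "continuous_on UNIV D"
    "compact (closure {x. \<phi> x \<noteq> 0})" "closure {x. \<phi> x \<noteq> 0} \<subseteq> \<Omega>" "continuous_on UNIV \<phi>"
proof -
  show d: "(\<phi> has_derivative (\<lambda>y. D x \<bullet> y)) (at x)" for x
    using assms by (simp add: C1c_test_def)
  show "continuous_on UNIV \<phi>"
    using has_derivative_continuous[OF d] by (simp add: continuous_on_eq_continuous_at)
qed (use assms in \<open>simp_all add: C1c_test_def\<close>)

text \<open>The definition constrains \<open>D\<close> only as a derivative. Off the support the
  function agrees with 0 on an open set, so uniqueness of the derivative forces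
  \<open>D x = 0\<close>.\<close>

lemma C1c_test_zero_outside:
  assumes "C1c_test \<Omega> \<phi> D" "x \<notin> closure {x. \<phi> x \<noteq> 0}"
  shows "\<phi> x = 0" "D x = 0"
proof -
  let ?U = "- closure {x. \<phi> x \<noteq> 0}"
  have z: "\<phi> y = 0" if "y \<in> ?U" for y
    using that closure_subset[of "{x. \<phi> x \<noteq> 0}"] by auto
  show "\<phi> x = 0" using z[of x] assms(2) by simp
  have "(\<phi> has_derivative (\<lambda>y. 0)) (at x)"
  proof (rule has_derivative_transform_within_open[of "\<lambda>_. 0" _ _ _ ?U])
    show "0 = \<phi> y" if "y \<in> ?U" for y using z[OF that] by simp
  qed (use assms(2) in \<open>simp_all add: open_Compl\<close>)
  then have "(\<lambda>y. D x \<bullet> y) = (\<lambda>y. 0)"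
    using C1c_testD(1)[OF assms(1)] by (rule has_derivative_unique[symmetric])
  then show "D x = 0" by (metis inner_eq_zero_iff)
qed

lemma C1c_testI:
  assumes "\<And>x. (\<phi> has_derivative (\<lambda>y. D x \<bullet> y)) (at x)" "continuous_on UNIV D"
    and "compact K" "K \<subseteq> \<Omega>" "\<And>x. x \<notin> K \<Longrightarrow> \<phi> x = 0"
  shows "C1c_test \<Omega> \<phi> D"
proof -
  have sub: "closure {x. \<phi> x \<noteq> 0} \<subseteq> K"
    using assms(3,5) by (intro closure_minimal compact_imp_closed) auto
  then have "compact (closure {x. \<phi> x \<noteq> 0})"
    using assms(3) by (meson bounded_subset closed_closure compact_eq_bounded_closed)
  then show ?thesis using assms sub by (auto simp: C1c_test_def)
qed

lemma C1c_test_bounded: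
  assumes "C1c_test \<Omega> \<phi> D"
  shows "\<exists>B\<ge>0. (\<forall>x. \<bar>\<phi> x\<bar> \<le> B) \<and> (\<forall>x. norm (D x) \<le> B)"
proof -
  let ?K = "closure {x. \<phi> x \<noteq> 0}"
  have "bounded (\<phi> ` ?K)" "bounded (D ` ?K)"
    using C1c_testD[OF assms]
    by (auto intro!: compact_imp_bounded compact_continuous_image intro: continuous_on_subset)
  then obtain B1 B2 where B: "\<And>x. x \<in> ?K \<Longrightarrow> norm (\<phi> x) \<le> B1" "\<And>x. x \<in> ?K \<Longrightarrow> norm (D x) \<le> B2"
    by (auto simp: bounded_iff)
  have "norm (\<phi> x) \<le> max 0 (max B1 B2) \<and> norm (D x) \<le> max 0 (max B1 B2)" for x
  proof (cases "x \<in> ?K")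
    case True
    then show ?thesis using B[of x] by (simp add: le_max_iff_disj)
  next
    case False
    then show ?thesis using C1c_test_zero_outside[OF assms False] by simp
  qed
  then show ?thesis by (intro exI[of _ "max 0 (max B1 B2)"]) auto
qed

lemma C1c_test_measurable:
  assumes "C1c_test \<Omega> \<phi> D"
  shows "\<phi> \<in> borel_measurable (lebesgue_on \<Omega>)" "D \<in> borel_measurable (lebesgue_on \<Omega>)"
  using C1c_testD(2,5)[OF assms]
  by (auto intro!: measurable_restrict_space1 measurable_completion borel_measurable_continuous_onI)

lemma finite_measure_lebesgue_on_bounded:
  fixes \<Omega> :: "'a::euclidean_space set"
  assumes "open \<Omega>" "bounded \<Omega>"
  shows "finite_measure (lebesgue_on \<Omega>)"
  using assms by (intro finite_measure_lebesgue_on lmeasurable_open)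

lemma C1c_test_square_integrable:
  fixes \<Omega> :: "'a::euclidean_space set"
  assumes "open \<Omega>" "bounded \<Omega>" "C1c_test \<Omega> \<phi> D"
  shows "square_integrable (lebesgue_on \<Omega>) \<phi>" "square_integrable (lebesgue_on \<Omega>) D"
proof -
  interpret finite_measure "lebesgue_on \<Omega>" by (rule finite_measure_lebesgue_on_bounded[OF assms(1,2)])
  note [measurable] = C1c_test_measurable[OF assms(3)]
  obtain B where B: "\<And>x. \<bar>\<phi> x\<bar> \<le> B" "\<And>x. norm (D x) \<le> B" "0 \<le> B" using C1c_test_bounded[OF assms(3)] by blast
  have "integrable (lebesgue_on \<Omega>) (\<lambda>x. (norm (\<phi> x))\<^sup>2)" "integrable (lebesgue_on \<Omega>) (\<lambda>x. (norm (D x))\<^sup>2)"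
    by (rule integrable_const_bound[where B="B\<^sup>2"]; simp add: abs_le_square_iff[symmetric] B power_mono)+
  then show "square_integrable (lebesgue_on \<Omega>) \<phi>" "square_integrable (lebesgue_on \<Omega>) D"
    by (auto simp: square_integrable_def)
qed

lemma C1c_test_add_scaleR:
  assumes "C1c_test \<Omega> \<phi> D" "C1c_test \<Omega> \<psi> E"
  shows "C1c_test \<Omega> (\<lambda>x. a * \<phi> x + b * \<psi> x) (\<lambda>x. a *\<^sub>R D x + b *\<^sub>R E x)"
proof (rule C1c_testI)
  show "((\<lambda>x. a * \<phi> x + b * \<psi> x) has_derivative (\<lambda>y. (a *\<^sub>R D x + b *\<^sub>R E x) \<bullet> y)) (at x)" for x
    by (auto intro!: derivative_eq_intros C1c_testD(1)[OF assms(1)] C1c_testD(1)[OF assms(2)]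
        simp: inner_add_left)
  show "continuous_on UNIV (\<lambda>x. a *\<^sub>R D x + b *\<^sub>R E x)"
    by (intro continuous_intros C1c_testD(2)[OF assms(1)] C1c_testD(2)[OF assms(2)])
  show "compact (closure {x. \<phi> x \<noteq> 0} \<union> closure {x. \<psi> x \<noteq> 0})"
    by (intro compact_Un C1c_testD(3)[OF assms(1)] C1c_testD(3)[OF assms(2)])
  show "closure {x. \<phi> x \<noteq> 0} \<union> closure {x. \<psi> x \<noteq> 0} \<subseteq> \<Omega>"
    using C1c_testD(4)[OF assms(1)] C1c_testD(4)[OF assms(2)] by simp
  show "a * \<phi> x + b * \<psi> x = 0" if "x \<notin> closure {x. \<phi> x \<noteq> 0} \<union> closure {x. \<psi> x \<noteq> 0}" for x
    using that C1c_test_zero_outside(1)[OF assms(1), of x] C1c_test_zero_outside(1)[OF assms(2), of x] by simp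
qed

lemma C1c_test_zero: "C1c_test \<Omega> (\<lambda>x. 0) (\<lambda>x. 0)"
  by (simp add: C1c_test_def)

lemma C1c_test_compose:
  assumes "C1c_test \<Omega> \<phi> D" and \<theta>: "\<And>s. (\<theta> has_field_derivative \<theta>' s) (at s)"
    and c: "continuous_on UNIV \<theta>'" and "\<theta> 0 = 0"
  shows "C1c_test \<Omega> (\<lambda>x. \<theta> (\<phi> x)) (\<lambda>x. \<theta>' (\<phi> x) *\<^sub>R D x)"
proof (rule C1c_testI)
  show "((\<lambda>x. \<theta> (\<phi> x)) has_derivative (\<lambda>y. (\<theta>' (\<phi> x) *\<^sub>R D x) \<bullet> y)) (at x)" for x
    using has_derivative_compose[OF C1c_testD(1)[OF assms(1), of x] \<theta>[unfolded has_field_derivative_def]]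
    by (simp add: mult.commute)
  show "continuous_on UNIV (\<lambda>x. \<theta>' (\<phi> x) *\<^sub>R D x)"
    using C1c_testD(2,5)[OF assms(1)]
    by (intro continuous_intros continuous_on_compose2[OF c]) auto
  show "\<theta> (\<phi> x) = 0" if "x \<notin> closure {x. \<phi> x \<noteq> 0}" for x
    using C1c_test_zero_outside(1)[OF assms(1) that] assms(4) by simp
qed (fact C1c_testD(3,4)[OF assms(1)])+

section \<open>The Poincare inequality for test functions\<close>

lemma integral_lborel_translate:
  fixes \<phi> :: "'a::euclidean_space \<Rightarrow> real"
  assumes "\<phi> \<in> borel_measurable borel"
  shows "(LINT x|lborel. \<phi> (x + b)) = (LINT x|lborel. \<phi> x)"
proof -
  have "(LINT x|lborel. \<phi> x) = (LINT x|distr lborel borel ((+) b). \<phi> x)"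
    by (simp add: lborel_distr_plus)
  also have "\<dots> = (LINT x|lborel. \<phi> (b + x))"
    using assms by (subst integral_distr) auto
  finally show ?thesis by (simp add: add.commute)
qed

text \<open>The difference quotients have integral zero by translation invariance of Lebesgue measure.\<close>

lemma integral_directional_derivative_zero:
  fixes \<phi> :: "'a::euclidean_space \<Rightarrow> real"
  assumes t: "C1c_test UNIV \<phi> D"
  shows "(LINT x|lborel. D x \<bullet> b) = 0"
proof -
  obtain B where B: "\<And>x. \<bar>\<phi> x\<bar> \<le> B" "\<And>x. norm (D x) \<le> B" "0 \<le> B" using C1c_test_bounded[OF t] by blast
  obtain R where R: "closure {x. \<phi> x \<noteq> 0} \<subseteq> cball 0 R"
    using compact_imp_bounded[OF C1c_testD(3)[OF t]] unfolding bounded_iff subset_iff mem_cball_0 by blast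
  have [measurable]: "\<phi> \<in> borel_measurable borel" "D \<in> borel_measurable borel"
    using C1c_testD(2,5)[OF t] by (auto intro: borel_measurable_continuous_onI)
  define q where "q n x = real (Suc n) * (\<phi> (x + (1 / real (Suc n)) *\<^sub>R b) - \<phi> x)" for n x
  have \<phi>int: "integrable lborel \<phi>"
  proof -
    have "integrable lborel (\<lambda>x. indicator (cball 0 R) x * \<phi> x)"
      using borel_integrable_compact[OF compact_cball continuous_on_subset[OF C1c_testD(5)[OF t] subset_UNIV]]
      by simp
    moreover have "indicator (cball 0 R) x * \<phi> x = \<phi> x" for x
      using subsetD[OF R, of x] C1c_test_zero_outside(1)[OF t, of x] by (cases "x \<in> cball 0 R") auto
    ultimately show ?thesis by simp
  qed
  have \<phi>int': "integrable lborel (\<lambda>x. \<phi> (x + c))" for c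
  proof -
    have "integrable (distr lborel borel ((+) c)) \<phi>" using \<phi>int by (simp add: lborel_distr_plus)
    then show ?thesis by (subst (asm) integrable_distr_eq) (auto simp: add.commute)
  qed
  have q0: "(LINT x|lborel. q n x) = 0" for n
    unfolding q_def using integral_lborel_translate[of \<phi>] \<phi>int \<phi>int' by simp
  have "(\<lambda>n. LINT x|lborel. q n x) \<longlonglongrightarrow> (LINT x|lborel. D x \<bullet> b)"
  proof (rule integral_dominated_convergence[where w = "\<lambda>x. B * norm b * indicator (cball 0 (R + norm b)) x"])
    show "integrable lborel (\<lambda>x. B * norm b * indicator (cball (0::'a) (R + norm b)) x :: real)"
      by (intro integrable_mult_right integrable_real_indicator) (use emeasure_bounded_finite[OF bounded_cball] in auto)
    show "AE x in lborel. (\<lambda>n. q n x) \<longlonglongrightarrow> D x \<bullet> b"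
    proof (rule AE_I2)
      fix x
      have "((\<lambda>s. x + s *\<^sub>R b) has_derivative (\<lambda>s. s *\<^sub>R b)) (at 0)"
        by (auto intro!: derivative_eq_intros)
      then have "((\<lambda>s. \<phi> (x + s *\<^sub>R b)) has_derivative (\<lambda>s. D x \<bullet> (s *\<^sub>R b))) (at 0)"
        by (rule has_derivative_compose) (simp add: C1c_testD(1)[OF t])
      then have "((\<lambda>s. \<phi> (x + s *\<^sub>R b)) has_field_derivative (D x \<bullet> b)) (at 0)"
        by (simp add: has_field_derivative_def mult.commute[of _ "D x \<bullet> b"])
      then have "((\<lambda>s. (\<phi> (x + s *\<^sub>R b) - \<phi> x) / s) \<longlongrightarrow> D x \<bullet> b) (at 0)"
        by (simp add: has_field_derivative_iff)
      moreover have "filterlim (\<lambda>n. 1 / real (Suc n)) (at 0) sequentially"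
        unfolding filterlim_at using tendsto_one_over_Suc by (auto simp del: of_nat_Suc)
      ultimately have "(\<lambda>n. (\<phi> (x + (1 / real (Suc n)) *\<^sub>R b) - \<phi> x) / (1 / real (Suc n))) \<longlonglongrightarrow> D x \<bullet> b"
        by (rule filterlim_compose)
      then show "(\<lambda>n. q n x) \<longlonglongrightarrow> D x \<bullet> b" by (simp add: q_def mult.commute)
    qed
    \<comment> \<open>The mean value inequality cancels the factor \<open>Suc n\<close> and leaves
      \<open>B * norm b\<close>. The shift has length at most \<open>norm b\<close>, so for
      \<open>norm x > R + norm b\<close> both \<open>x\<close> and its translate lie outside the
      support.\<close>
    show "AE x in lborel. norm (q n x) \<le> B * norm b * indicator (cball 0 (R + norm b)) x" for n
    proof (rule AE_I2)
      fix x
      let ?y = "x + (1 / real (Suc n)) *\<^sub>R b"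
      have yx: "norm (?y - x) \<le> norm b" "norm (?y - x) = norm b / real (Suc n)"
        by (simp_all add: field_simps)
      show "norm (q n x) \<le> B * norm b * indicator (cball 0 (R + norm b)) x"
      proof (cases "x \<in> cball 0 (R + norm b)")
        case True
        have "norm (\<phi> ?y - \<phi> x) \<le> B * norm (?y - x)"
        proof (rule differentiable_bound[of UNIV \<phi> "\<lambda>x y. D x \<bullet> y"])
          show "onorm (\<lambda>y. D z \<bullet> y) \<le> B" for z
          proof (rule onorm_le)
            fix y
            have "norm (D z \<bullet> y) \<le> norm (D z) * norm y" by (simp add: Cauchy_Schwarz_ineq2)
            also have "\<dots> \<le> B * norm y" by (intro mult_right_mono B) simp
            finally show "norm (D z \<bullet> y) \<le> B * norm y" .
          qed
        qed (auto intro: C1c_testD(1)[OF t])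
        then have "real (Suc n) * norm (\<phi> ?y - \<phi> x) \<le> real (Suc n) * (B * (norm b / real (Suc n)))"
          unfolding yx(2) by (rule mult_left_mono) simp
        then show ?thesis using True by (simp add: q_def abs_mult del: of_nat_Suc)
      next
        case False
        then have n: "norm x > R + norm b" by simp
        have "norm x \<le> norm ?y + norm (?y - x)" by (metis add.commute add_diff_cancel_left' norm_minus_commute norm_triangle_sub)
        then have "norm ?y > R" using n yx(1) by linarith
        moreover have "norm x > R" using n norm_ge_zero[of b] by linarith
        ultimately have "\<phi> ?y = 0" "\<phi> x = 0"
          using R by (intro C1c_test_zero_outside(1)[OF t]; force)+
        then show ?thesis using False by (simp add: q_def)
      qed
    qed
  qed (auto simp: q_def)
  then show ?thesis by (simp add: q0 LIMSEQ_const_iff)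
qed

lemma integral_lebesgue_on_eq_lborel:
  fixes u :: "'a::euclidean_space \<Rightarrow> real"
  assumes "open \<Omega>" "u \<in> borel_measurable borel" "\<And>x. x \<notin> \<Omega> \<Longrightarrow> u x = 0"
  shows "(LINT x|lebesgue_on \<Omega>. u x) = (LINT x|lborel. u x)"
proof -
  have "(LINT x|lebesgue_on \<Omega>. u x) = (LINT x|lebesgue. indicator \<Omega> x *\<^sub>R u x)"
    using assms(1) by (subst integral_restrict_space) auto
  also have "(\<lambda>x. indicator \<Omega> x *\<^sub>R u x) = u" using assms(3) by (auto simp: indicator_def fun_eq_iff)
  finally show ?thesis using assms(2) by (simp add: integral_completion)
qed

text \<open>Integrate the derivative of \<open>(x \<bullet> b) \<phi>\<^sup>2\<close> in a fixed direction \<open>b\<close>.\<close>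

lemma Poincare_C1c:
  fixes \<Omega> :: "'a::euclidean_space set"
  assumes \<Omega>: "open \<Omega>" "bounded \<Omega>"
  shows "\<exists>K\<ge>0. \<forall>\<phi> D. C1c_test \<Omega> \<phi> D \<longrightarrow>
    sq_norm (lebesgue_on \<Omega>) \<phi> \<le> K * sq_norm (lebesgue_on \<Omega>) D"
proof -
  obtain R where R: "\<And>x. x \<in> \<Omega> \<Longrightarrow> norm x \<le> R" using \<Omega>(2) by (auto simp: bounded_iff)
  obtain b :: 'a where b: "b \<in> Basis" using nonempty_Basis by blast
  let ?M = "lebesgue_on \<Omega>"
  have "sq_norm ?M \<phi> \<le> (4 * R\<^sup>2) * sq_norm ?M D" if t: "C1c_test \<Omega> \<phi> D" for \<phi> D
  proof -
    define E where "E x = (\<phi> x)\<^sup>2 *\<^sub>R b + (2 * (x \<bullet> b) * \<phi> x) *\<^sub>R D x" for x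
    have t': "C1c_test UNIV (\<lambda>x. (x \<bullet> b) * (\<phi> x)\<^sup>2) E"
    proof (rule C1c_testI[OF _ _ C1c_testD(3)[OF t]])
      show "((\<lambda>x. (x \<bullet> b) * (\<phi> x)\<^sup>2) has_derivative (\<lambda>y. E x \<bullet> y)) (at x)" for x
        by (auto intro!: derivative_eq_intros C1c_testD(1)[OF t] simp: E_def algebra_simps inner_commute)
      show "continuous_on UNIV E"
        unfolding E_def by (intro continuous_intros C1c_testD(2,5)[OF t])
      show "(x \<bullet> b) * (\<phi> x)\<^sup>2 = 0" if "x \<notin> closure {x. \<phi> x \<noteq> 0}" for x
        using C1c_test_zero_outside(1)[OF t that] by simp
    qed simp
    have Eb: "E x \<bullet> b = (norm (\<phi> x))\<^sup>2 + 2 * (x \<bullet> b) * \<phi> x * (D x \<bullet> b)" for x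
      using b by (simp add: E_def inner_add_left)
    have "E x = 0" if "x \<notin> \<Omega>" for x
    proof -
      have "\<phi> x = 0" using C1c_testD(4)[OF t] C1c_test_zero_outside(1)[OF t, of x] that by blast
      then show ?thesis by (simp add: E_def)
    qed
    moreover have [measurable]: "E \<in> borel_measurable borel"
      using C1c_testD(2)[OF t'] by (rule borel_measurable_continuous_onI)
    ultimately have z: "(LINT x|?M. E x \<bullet> b) = 0"
      using integral_directional_derivative_zero[OF t', of b] \<Omega>(1)
      by (subst integral_lebesgue_on_eq_lborel) auto
    note sq = C1c_test_square_integrable[OF \<Omega> t]
    have x: "x \<in> borel_measurable ?M" if "continuous_on UNIV x" for x :: "'a \<Rightarrow> real"
      using that by (auto intro!: measurable_restrict_space1 measurable_completion borel_measurable_continuous_onI)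
    note [measurable] = square_integrableD(1)[OF sq(1)] square_integrableD(1)[OF sq(2)]
    \<comment> \<open>Young's inequality with weights such that exactly half of
      \<open>sq_norm ?M \<phi>\<close> appears on the right. Absorbing it on the left doubles
      \<open>2 * R\<^sup>2\<close> to the final constant \<open>4 * R\<^sup>2\<close>.\<close>
    define w where "w x = 1/2 * (norm (\<phi> x))\<^sup>2 + 2 * R\<^sup>2 * (norm (D x))\<^sup>2" for x
    have wi: "integrable ?M w" unfolding w_def using sq by (auto simp: square_integrable_def)
    have bd: "\<bar>2 * (x \<bullet> b) * \<phi> x * (D x \<bullet> b)\<bar> \<le> w x" if "x \<in> \<Omega>" for x
    proof -
      have "\<bar>x \<bullet> b\<bar> \<le> R" "\<bar>D x \<bullet> b\<bar> \<le> norm (D x)"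
        using R[OF that] b Basis_le_norm[OF b, of x] Basis_le_norm[OF b, of "D x"] by auto
      then have "2 * (\<bar>x \<bullet> b\<bar> * \<bar>\<phi> x\<bar> * \<bar>D x \<bullet> b\<bar>) \<le> 2 * (R * \<bar>\<phi> x\<bar> * norm (D x))"
        by (intro mult_mono) auto
      also have "\<dots> \<le> w x"
        using sum_squares_bound[of "\<bar>\<phi> x\<bar>" "2 * R * norm (D x)"]
        by (simp add: w_def power2_eq_square algebra_simps)
      finally show ?thesis by (simp add: abs_mult)
    qed
    have ri: "integrable ?M (\<lambda>x. 2 * (x \<bullet> b) * \<phi> x * (D x \<bullet> b))"
      using wi
      by (rule Bochner_Integration.integrable_bound)
         (use bd \<Omega>(1) in \<open>auto intro!: x continuous_intros C1c_testD(2,5)[OF t] AE_I2 order_trans[OF bd]\<close>)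
    have "sq_norm ?M \<phi> = (LINT x|?M. E x \<bullet> b) - (LINT x|?M. 2 * (x \<bullet> b) * \<phi> x * (D x \<bullet> b))"
      unfolding Eb sq_norm_def using sq ri by (simp add: square_integrable_def)
    also have "\<dots> = (LINT x|?M. - (2 * (x \<bullet> b) * \<phi> x * (D x \<bullet> b)))" using z by simp
    also have "\<dots> \<le> (LINT x|?M. w x)"
      using ri wi \<Omega>(1) by (intro integral_mono integrable_minus) (auto dest!: bd simp: abs_le_iff)
    also have "\<dots> = 1/2 * sq_norm ?M \<phi> + 2 * R\<^sup>2 * sq_norm ?M D"
      unfolding w_def sq_norm_def using sq by (simp add: square_integrable_def)
    finally show ?thesis by simp
  qed
  then show ?thesis by (intro exI[of _ "4 * R\<^sup>2"]) simp
qed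

text \<open>The Poincare inequality is available for test functions only. The approximating
  gradients tend to \<open>G = 0\<close>, so the approximating functions tend to 0 in L2 as well as
  to \<open>v\<close>. This is how the zero boundary values enter the truncation and uniqueness
  arguments.\<close>

lemma H10_zero_gradient:
  fixes \<Omega> :: "'a::euclidean_space set"
  assumes \<Omega>: "open \<Omega>" "bounded \<Omega>" and "H10 \<Omega> v G" and z: "AE x in lebesgue_on \<Omega>. G x = 0"
  shows "AE x in lebesgue_on \<Omega>. v x = 0"
proof -
  let ?M = "lebesgue_on \<Omega>"
  obtain \<phi> D where v: "square_integrable ?M v" and t: "\<And>k. C1c_test \<Omega> (\<phi> k) (D k)"
    and 1: "(\<lambda>k. sq_norm ?M (\<lambda>x. \<phi> k x - v x)) \<longlonglongrightarrow> 0" and 2: "(\<lambda>k. sq_norm ?M (\<lambda>x. D k x - G x)) \<longlonglongrightarrow> 0"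
    using assms(3) by (auto simp: H10_iff)
  obtain K where K: "0 \<le> K" "\<And>\<phi> D. C1c_test \<Omega> \<phi> D \<Longrightarrow> sq_norm ?M \<phi> \<le> K * sq_norm ?M D"
    using Poincare_C1c[OF \<Omega>] by blast
  have eq: "sq_norm ?M (\<lambda>x. D k x - G x) = sq_norm ?M (D k)" for k
  proof -
    have "G \<in> borel_measurable ?M" using assms(3) by (simp add: H10_iff square_integrable_def)
    then show ?thesis unfolding sq_norm_def using z C1c_test_measurable[OF t[of k]]
      by (intro integral_cong_AE) auto
  qed
  have "sq_norm ?M v \<le> 2 * (K * sq_norm ?M (\<lambda>x. D k x - G x)) + 2 * sq_norm ?M (\<lambda>x. \<phi> k x - v x)" for k
  proof -
    have "sq_norm ?M v \<le> 2 * sq_norm ?M (\<phi> k) + 2 * sq_norm ?M (\<lambda>x. \<phi> k x - v x)"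
      using sq_norm_diff_le[of ?M "\<phi> k" "\<lambda>x. \<phi> k x - v x"] v
        C1c_test_square_integrable(1)[OF \<Omega> t[of k]] by (simp add: square_integrable_diff)
    then show ?thesis unfolding eq using K(2)[OF t[of k]] by linarith
  qed
  moreover have "(\<lambda>k. 2 * (K * sq_norm ?M (\<lambda>x. D k x - G x)) + 2 * sq_norm ?M (\<lambda>x. \<phi> k x - v x)) \<longlonglongrightarrow> 2 * (K * 0) + 2 * 0"
    by (intro tendsto_intros 1 2)
  ultimately have "sq_norm ?M v \<le> 0" by (auto intro: LIMSEQ_le_const)
  then have "sq_norm ?M v = 0" using sq_norm_nonneg[of ?M v] by simp
  then have "(LINT x|?M. (norm (v x))\<^sup>2) = 0" by (simp only: sq_norm_def)
  then show ?thesis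
    using v integral_nonneg_eq_0_iff_AE[of ?M "\<lambda>x. (norm (v x))\<^sup>2"] by (simp add: square_integrable_def)
qed

section \<open>Operations on \<open>H10\<close>: differences and C1 substitutions\<close>

lemma H10_diff:
  fixes \<Omega> :: "'a::euclidean_space set"
  assumes \<Omega>: "open \<Omega>" "bounded \<Omega>" and "H10 \<Omega> v G" "H10 \<Omega> w W"
  shows "H10 \<Omega> (\<lambda>x. v x - w x) (\<lambda>x. G x - W x)"
proof -
  let ?M = "lebesgue_on \<Omega>"
  obtain \<phi> D where v: "square_integrable ?M v" "square_integrable ?M G" and t: "\<And>k. C1c_test \<Omega> (\<phi> k) (D k)"
    and 1: "(\<lambda>k. sq_norm ?M (\<lambda>x. \<phi> k x - v x)) \<longlonglongrightarrow> 0" and 2: "(\<lambda>k. sq_norm ?M (\<lambda>x. D k x - G x)) \<longlonglongrightarrow> 0"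
    using assms(3) by (auto simp: H10_iff)
  obtain \<psi> E where w: "square_integrable ?M w" "square_integrable ?M W" and s: "\<And>k. C1c_test \<Omega> (\<psi> k) (E k)"
    and 3: "(\<lambda>k. sq_norm ?M (\<lambda>x. \<psi> k x - w x)) \<longlonglongrightarrow> 0" and 4: "(\<lambda>k. sq_norm ?M (\<lambda>x. E k x - W x)) \<longlonglongrightarrow> 0"
    using assms(4) by (auto simp: H10_iff)
  have conv: "(\<lambda>k. sq_norm ?M (\<lambda>x. (a k x - b k x) - (c x - d x))) \<longlonglongrightarrow> 0"
    if "\<And>k. square_integrable ?M (a k)" "\<And>k. square_integrable ?M (b k)" "square_integrable ?M c" "square_integrable ?M d"
      "(\<lambda>k. sq_norm ?M (\<lambda>x. a k x - c x)) \<longlonglongrightarrow> 0" "(\<lambda>k. sq_norm ?M (\<lambda>x. b k x - d x)) \<longlonglongrightarrow> 0"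
    for a b :: "nat \<Rightarrow> 'a \<Rightarrow> 'c::euclidean_space" and c d
  proof -
    have "(\<lambda>k. 2 * sq_norm ?M (\<lambda>x. a k x - c x) + 2 * sq_norm ?M (\<lambda>x. b k x - d x)) \<longlonglongrightarrow> 2 * 0 + 2 * 0"
      by (intro tendsto_intros that(5,6))
    then have lim: "(\<lambda>k. 2 * sq_norm ?M (\<lambda>x. a k x - c x) + 2 * sq_norm ?M (\<lambda>x. b k x - d x)) \<longlonglongrightarrow> 0"
      by simp
    have "norm (sq_norm ?M (\<lambda>x. (a k x - b k x) - (c x - d x)))
       \<le> 2 * sq_norm ?M (\<lambda>x. a k x - c x) + 2 * sq_norm ?M (\<lambda>x. b k x - d x)" for k
      using sq_norm_diff_le[OF square_integrable_diff[OF that(1)[of k] that(3)] square_integrable_diff[OF that(2)[of k] that(4)]]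
      by (simp add: sq_norm_nonneg algebra_simps)
    then show ?thesis by (intro Lim_null_comparison[OF always_eventually lim] allI)
  qed
  have "C1c_test \<Omega> (\<lambda>x. \<phi> k x - \<psi> k x) (\<lambda>x. D k x - E k x)" for k
    using C1c_test_add_scaleR[OF t[of k] s[of k], of 1 "-1"] by simp
  moreover note conv[OF C1c_test_square_integrable(1)[OF \<Omega> t] C1c_test_square_integrable(1)[OF \<Omega> s] v(1) w(1) 1 3]
    conv[OF C1c_test_square_integrable(2)[OF \<Omega> t] C1c_test_square_integrable(2)[OF \<Omega> s] v(2) w(2) 2 4]
  ultimately show ?thesis
    unfolding H10_iff using v w
    by (intro conjI square_integrable_diff exI[of _ "\<lambda>k x. \<phi> k x - \<psi> k x"] exI[of _ "\<lambda>k x. D k x - E k x"]) auto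
qed

text \<open>The gradient error splits as \<open>\<theta>' (\<phi> k) (D k - G) + (\<theta>' (\<phi>
  k) - \<theta>' v) G\<close>. The bound on \<open>\<theta>'\<close> controls the first term by the
  L2 convergence of gradients. The second tends to 0 by dominated convergence with majorant
  \<open>4 |G|^2\<close>, which needs almost everywhere convergence of \<open>\<phi> k\<close>;
  hence the passage to a subsequence at the start.\<close>

lemma H10_compose:
  fixes \<Omega> :: "'a::euclidean_space set"
  assumes \<Omega>: "open \<Omega>" "bounded \<Omega>" and H: "H10 \<Omega> v G"
    and \<theta>: "\<And>s. (\<theta> has_field_derivative \<theta>' s) (at s)"
    and c: "continuous_on UNIV \<theta>'" and \<theta>0: "\<theta> 0 = 0" and b: "\<And>s. \<bar>\<theta>' s\<bar> \<le> 1"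
  shows "H10 \<Omega> (\<lambda>x. \<theta> (v x)) (\<lambda>x. \<theta>' (v x) *\<^sub>R G x)"
proof -
  let ?M = "lebesgue_on \<Omega>"
  obtain \<phi>0 D0 where v: "square_integrable ?M v" "square_integrable ?M G" and t0: "\<And>k. C1c_test \<Omega> (\<phi>0 k) (D0 k)"
    and 10: "(\<lambda>k. sq_norm ?M (\<lambda>x. \<phi>0 k x - v x)) \<longlonglongrightarrow> 0" and 20: "(\<lambda>k. sq_norm ?M (\<lambda>x. D0 k x - G x)) \<longlonglongrightarrow> 0"
    using H by (auto simp: H10_iff)
  obtain r where r: "strict_mono r" "AE x in ?M. (\<lambda>k. \<phi>0 (r k) x) \<longlonglongrightarrow> v x"
    using AE_subseq_of_sq_norm[OF C1c_test_square_integrable(1)[OF \<Omega> t0] v(1) 10] .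
  define \<phi> where "\<phi> k = \<phi>0 (r k)" for k
  define D where "D k = D0 (r k)" for k
  have t: "C1c_test \<Omega> (\<phi> k) (D k)" for k using t0 by (simp add: \<phi>_def D_def)
  have 1: "(\<lambda>k. sq_norm ?M (\<lambda>x. \<phi> k x - v x)) \<longlonglongrightarrow> 0" and 2: "(\<lambda>k. sq_norm ?M (\<lambda>x. D k x - G x)) \<longlonglongrightarrow> 0"
    using LIMSEQ_subseq_LIMSEQ[OF 10 r(1)] LIMSEQ_subseq_LIMSEQ[OF 20 r(1)] by (auto simp: o_def \<phi>_def D_def)
  have ae: "AE x in ?M. (\<lambda>k. \<phi> k x) \<longlonglongrightarrow> v x" using r(2) by (simp add: \<phi>_def)
  note sq = C1c_test_square_integrable[OF \<Omega> t]
  have [measurable]: "\<theta>' \<in> borel_measurable borel" using c by (rule borel_measurable_continuous_onI)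
  have [measurable]: "\<theta> \<in> borel_measurable borel"
    using \<theta> by (intro borel_measurable_continuous_onI DERIV_continuous_on) (auto intro: has_field_derivative_at_within)
  note [measurable] = square_integrableD(1)[OF v(1)] square_integrableD(1)[OF v(2)]
    C1c_test_measurable[OF t]
  have lip: "\<bar>\<theta> s - \<theta> s'\<bar> \<le> \<bar>s - s'\<bar>" for s s'
    using field_differentiable_bound[of UNIV \<theta> \<theta>' 1 s s'] b \<theta> by (auto intro: has_field_derivative_at_within)
  have sqt: "square_integrable ?M (\<lambda>x. \<theta> (v x))"
  proof -
    have "integrable ?M (\<lambda>x. (norm (\<theta> (v x)))\<^sup>2)"
      by (rule Bochner_Integration.integrable_bound[OF square_integrableD(2)[OF v(1)]])
         (use lip[of _ 0] \<theta>0 in \<open>auto simp: abs_le_square_iff\<close>)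
    then show ?thesis by (simp add: square_integrable_def)
  qed
  have sqm: "square_integrable ?M (\<lambda>x. m x *\<^sub>R U x)"
    if [measurable]: "m \<in> borel_measurable ?M" and m: "\<And>x. \<bar>m x\<bar> \<le> B" and U: "square_integrable ?M U"
    for m :: "'a \<Rightarrow> real" and U :: "'a \<Rightarrow> 'a" and B
  proof -
    note [measurable] = square_integrableD(1)[OF U]
    have "integrable ?M (\<lambda>x. B\<^sup>2 * (norm (U x))\<^sup>2)" using U by (simp add: square_integrable_def)
    then have "integrable ?M (\<lambda>x. (norm (m x *\<^sub>R U x))\<^sup>2)"
      by (rule Bochner_Integration.integrable_bound)
         (use m in \<open>auto simp: power_mult_distrib abs_le_square_iff[symmetric] intro!: mult_right_mono AE_I2 order_trans[OF m]\<close>)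
    then show ?thesis by (simp add: square_integrable_def)
  qed
  have sqG: "square_integrable ?M (\<lambda>x. \<theta>' (v x) *\<^sub>R G x)" by (rule sqm[OF _ b v(2)]) simp
  have conv1: "(\<lambda>k. sq_norm ?M (\<lambda>x. \<theta> (\<phi> k x) - \<theta> (v x))) \<longlonglongrightarrow> 0"
  proof (rule Lim_null_comparison[OF always_eventually 1], rule allI)
    fix k
    note tk = C1c_test_square_integrable(1)[OF \<Omega> C1c_test_compose[OF t[of k] \<theta> c \<theta>0]]
    have "sq_norm ?M (\<lambda>x. \<theta> (\<phi> k x) - \<theta> (v x)) \<le> sq_norm ?M (\<lambda>x. \<phi> k x - v x)"
      unfolding sq_norm_def
      using square_integrable_diff[OF tk sqt] square_integrable_diff[OF sq(1)[of k] v(1)] lip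
      by (intro integral_mono) (auto simp: square_integrable_def abs_le_square_iff[symmetric])
    then show "norm (sq_norm ?M (\<lambda>x. \<theta> (\<phi> k x) - \<theta> (v x))) \<le> sq_norm ?M (\<lambda>x. \<phi> k x - v x)"
      by (simp add: sq_norm_nonneg)
  qed
  have dct: "(\<lambda>k. sq_norm ?M (\<lambda>x. (\<theta>' (\<phi> k x) - \<theta>' (v x)) *\<^sub>R G x)) \<longlonglongrightarrow> (LINT x|?M. 0)"
    unfolding sq_norm_def
  proof (rule integral_dominated_convergence[where w = "\<lambda>x. 4 * (norm (G x))\<^sup>2"])
    show "integrable ?M (\<lambda>x. 4 * (norm (G x))\<^sup>2)" using v(2) by (simp add: square_integrable_def)
    show "AE x in ?M. (\<lambda>k. (norm ((\<theta>' (\<phi> k x) - \<theta>' (v x)) *\<^sub>R G x))\<^sup>2) \<longlonglongrightarrow> 0"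
      using ae
    proof eventually_elim
      case (elim x)
      have "(\<lambda>k. \<theta>' (\<phi> k x)) \<longlonglongrightarrow> \<theta>' (v x)"
        using c elim by (auto simp: continuous_on_eq_continuous_at intro: isCont_tendsto_compose)
      then have "(\<lambda>k. (norm ((\<theta>' (\<phi> k x) - \<theta>' (v x)) *\<^sub>R G x))\<^sup>2) \<longlonglongrightarrow> (norm ((\<theta>' (v x) - \<theta>' (v x)) *\<^sub>R G x))\<^sup>2"
        by (intro tendsto_intros)
      then show ?case by simp
    qed
    show "AE x in ?M. norm ((norm ((\<theta>' (\<phi> k x) - \<theta>' (v x)) *\<^sub>R G x))\<^sup>2) \<le> 4 * (norm (G x))\<^sup>2" for k
    proof (rule AE_I2)
      fix x
      have "\<bar>\<theta>' (\<phi> k x) - \<theta>' (v x)\<bar> \<le> 2" using b[of "\<phi> k x"] b[of "v x"] by linarith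
      then have "(\<bar>\<theta>' (\<phi> k x) - \<theta>' (v x)\<bar>)\<^sup>2 \<le> 2\<^sup>2" by (intro power_mono) auto
      then show "norm ((norm ((\<theta>' (\<phi> k x) - \<theta>' (v x)) *\<^sub>R G x))\<^sup>2) \<le> 4 * (norm (G x))\<^sup>2"
        by (simp add: power_mult_distrib mult_right_mono)
    qed
  qed auto
  have conv2: "(\<lambda>k. sq_norm ?M (\<lambda>x. \<theta>' (\<phi> k x) *\<^sub>R D k x - \<theta>' (v x) *\<^sub>R G x)) \<longlonglongrightarrow> 0"
  proof (rule Lim_null_comparison[OF always_eventually], rule allI)
    fix k
    note dk = square_integrable_diff[OF sq(2)[of k] v(2)]
    have s1: "square_integrable ?M (\<lambda>x. \<theta>' (\<phi> k x) *\<^sub>R (D k x - G x))"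
      by (rule sqm[OF _ b dk]) simp
    have s2: "square_integrable ?M (\<lambda>x. (\<theta>' (\<phi> k x) - \<theta>' (v x)) *\<^sub>R G x)"
    proof (rule sqm[OF _ _ v(2)])
      show "\<bar>\<theta>' (\<phi> k x) - \<theta>' (v x)\<bar> \<le> 2" for x using b[of "\<phi> k x"] b[of "v x"] by linarith
    qed simp
    have "sq_norm ?M (\<lambda>x. \<theta>' (\<phi> k x) *\<^sub>R (D k x - G x)) \<le> sq_norm ?M (\<lambda>x. D k x - G x)"
      unfolding sq_norm_def using s1 dk b
      by (intro integral_mono) (auto simp: square_integrable_def power_mult_distrib abs_square_le_1 intro!: mult_left_le_one_le)
    moreover have "sq_norm ?M (\<lambda>x. \<theta>' (\<phi> k x) *\<^sub>R D k x - \<theta>' (v x) *\<^sub>R G x)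
      \<le> 2 * sq_norm ?M (\<lambda>x. \<theta>' (\<phi> k x) *\<^sub>R (D k x - G x)) + 2 * sq_norm ?M (\<lambda>x. (\<theta>' (\<phi> k x) - \<theta>' (v x)) *\<^sub>R G x)"
      using sq_norm_add_le[OF s1 s2] by (simp add: algebra_simps)
    ultimately show "norm (sq_norm ?M (\<lambda>x. \<theta>' (\<phi> k x) *\<^sub>R D k x - \<theta>' (v x) *\<^sub>R G x))
      \<le> 2 * sq_norm ?M (\<lambda>x. D k x - G x) + 2 * sq_norm ?M (\<lambda>x. (\<theta>' (\<phi> k x) - \<theta>' (v x)) *\<^sub>R G x)"
      by (simp add: sq_norm_nonneg)
  next
    have "(\<lambda>k. 2 * sq_norm ?M (\<lambda>x. D k x - G x) + 2 * sq_norm ?M (\<lambda>x. (\<theta>' (\<phi> k x) - \<theta>' (v x)) *\<^sub>R G x)) \<longlonglongrightarrow> 2 * 0 + 2 * (LINT x|?M. 0)"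
      by (intro tendsto_intros 2 dct)
    then show "(\<lambda>k. 2 * sq_norm ?M (\<lambda>x. D k x - G x) + 2 * sq_norm ?M (\<lambda>x. (\<theta>' (\<phi> k x) - \<theta>' (v x)) *\<^sub>R G x)) \<longlonglongrightarrow> 0" by simp
  qed
  show ?thesis
    unfolding H10_iff using sqt sqG conv1 conv2 C1c_test_compose[OF t \<theta> c \<theta>0]
    by (intro conjI exI[of _ "\<lambda>k x. \<theta> (\<phi> k x)"] exI[of _ "\<lambda>k x. \<theta>' (\<phi> k x) *\<^sub>R D k x"]) auto
qed

section \<open>Minimisation and the weak equation\<close>

lemma integrable_mult_bounded:
  fixes f w :: "'x \<Rightarrow> real"
  assumes "integrable M f" "w \<in> borel_measurable M" "AE x in M. \<bar>w x\<bar> \<le> B"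
  shows "integrable M (\<lambda>x. f x * w x)"
proof -
  have [measurable]: "f \<in> borel_measurable M" "w \<in> borel_measurable M" using assms by auto
  have "integrable M (\<lambda>x. B * \<bar>f x\<bar>)" using assms(1) by simp
  then show ?thesis
  proof (rule Bochner_Integration.integrable_bound)
    show "AE x in M. norm (f x * w x) \<le> norm (B * \<bar>f x\<bar>)"
      using assms(3)
    proof eventually_elim
      case (elim x)
      then have "\<bar>w x\<bar> * \<bar>f x\<bar> \<le> B * \<bar>f x\<bar>" by (intro mult_right_mono) auto
      then show ?case using elim by (simp add: abs_mult mult.commute)
    qed
  qed simp
qed

text \<open>The second conjunct says that \<open>- g a\<close> is a subgradient of \<open>F\<close>
  at \<open>a\<close>; it follows by comparing the integral of the antitone \<open>g\<close> over an
  interval with its endpoint values.\<close>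

lemma convex_potential_exists:
  fixes g :: "real \<Rightarrow> real"
  assumes cont: "continuous_on UNIV g" and anti: "antimono g" and g0: "\<And>s. 0 \<le> g s"
    and gL: "\<And>s. L \<le> s \<Longrightarrow> g s = 0"
  shows "\<exists>F. (\<forall>s. 0 \<le> F s) \<and> (\<forall>a b. F a - g a * (b - a) \<le> F b)"
proof -
  \<comment> \<open>Integrating up to \<open>L\<close> normalises the potential to be nonnegative.
    For \<open>s > L\<close> the interval is empty and \<open>F s = 0\<close>, consistent with
    \<open>g\<close> vanishing there.\<close>
  define F where "F s = integral {s..L} g" for s
  have gi: "g integrable_on {a..b}" for a b
    using cont by (intro integrable_continuous_real) (auto intro: continuous_on_subset)
  have z: "integral {a..b} g = 0" if "L \<le> a" for a b
    using integral_cong[of "{a..b}" g "\<lambda>_. 0"] gL that by simp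
  have diff: "F a - F b = integral {a..b} g" if "a \<le> b" for a b
  proof (cases "b \<le> L")
    case True
    then show ?thesis
      unfolding F_def using Henstock_Kurzweil_Integration.integral_combine[OF that True gi] by simp
  next
    case bL: False
    show ?thesis
    proof (cases "a \<le> L")
      case True
      have "L \<le> b" using bL by simp
      then show ?thesis
        unfolding F_def
        using Henstock_Kurzweil_Integration.integral_combine[OF True \<open>L \<le> b\<close> gi] z[of L b] bL by simp
    next
      case False
      then show ?thesis unfolding F_def using bL z[of a b] by simp
    qed
  qed
  have upper: "integral {a..b} g \<le> g a * (b - a)" and lower: "g b * (b - a) \<le> integral {a..b} g" if "a \<le> b" for a b
  proof -
    have "integral {a..b} g \<le> integral {a..b} (\<lambda>_. g a)"
      using anti by (intro integral_le gi) (auto simp: antimonoD)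
    then show "integral {a..b} g \<le> g a * (b - a)" using that by (simp add: mult.commute)
    have "integral {a..b} (\<lambda>_. g b) \<le> integral {a..b} g"
      using anti by (intro integral_le gi) (auto simp: antimonoD)
    then show "g b * (b - a) \<le> integral {a..b} g" using that by (simp add: mult.commute)
  qed
  have "F a - g a * (b - a) \<le> F b" for a b
  proof (cases "a \<le> b")
    case True
    then show ?thesis using diff[OF True] upper[OF True] by linarith
  next
    case False
    then have "b \<le> a" by simp
    then show ?thesis using diff[OF \<open>b \<le> a\<close>] lower[OF \<open>b \<le> a\<close>] by (simp add: algebra_simps)
  qed
  moreover have "0 \<le> F s" for s unfolding F_def using g0 by (intro integral_nonneg gi) auto
  ultimately show ?thesis by blast
qed

text \<open>The \<open>k\<close>-th term of the minimising sequence, of energy defect at most \<open>1 / (k + 1)\<^sup>2\<close>, is compared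
  with its perturbation by \<open>\<psi> / (k + 1)\<close>; a single passage to the limit then gives the equation.\<close>

lemma weak_solution_on_test_functions:
  fixes \<Omega> :: "'a::euclidean_space set" and f :: "'a \<Rightarrow> real" and g :: "real \<Rightarrow> real"
  assumes \<Omega>: "open \<Omega>" "bounded \<Omega>" and f: "integrable (lebesgue_on \<Omega>) f"
    and f0: "AE x in lebesgue_on \<Omega>. 0 \<le> f x"
    and cont: "continuous_on UNIV g" and anti: "antimono g"
    and g0: "\<And>s. 0 \<le> g s" and g1: "\<And>s. g s \<le> 1"
    and gL: "\<And>s. L \<le> s \<Longrightarrow> g s = 0"
  shows "\<exists>v G. H10 \<Omega> v G \<and> (\<forall>\<psi> P. C1c_test \<Omega> \<psi> P \<longrightarrow>
    (LINT x|lebesgue_on \<Omega>. G x \<bullet> P x) = (LINT x|lebesgue_on \<Omega>. f x * g (v x) * \<psi> x))"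
proof -
  let ?M = "lebesgue_on \<Omega>"
  obtain F where F0: "\<And>s. 0 \<le> F s" and sub: "\<And>a b. F a - g a * (b - a) \<le> F b"
    using convex_potential_exists[OF cont anti g0 gL] by blast
  \<comment> \<open>Antitonicity has two uses: it supplies the measurability on which the existence
    statement for \<open>F\<close> is silent, and it bounds \<open>F (\<phi> x)\<close> by
    \<open>F (- B)\<close> when the values of \<open>\<phi>\<close> lie in
    \<open>[-B, B]\<close>.\<close>
  have Fanti: "F b \<le> F a" if "a \<le> b" for a b
    using sub[of b a] g0[of b] that mult_nonneg_nonneg[of "g b" "b - a"] by (simp add: algebra_simps)
  have "mono (\<lambda>s. - F s)" using Fanti by (simp add: mono_def)
  then have [measurable]: "F \<in> borel_measurable borel"
    using borel_measurable_mono borel_measurable_uminus_eq by blast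
  have [measurable]: "g \<in> borel_measurable borel" using cont by (rule borel_measurable_continuous_onI)
  have [measurable]: "f \<in> borel_measurable ?M" using f by auto
  \<comment> \<open>The subgradient inequality at the midpoint, evaluated at both ends; the linear
    terms cancel in the sum.\<close>
  have mid: "F ((a + b) / 2) \<le> (F a + F b) / 2" for a b
  proof -
    have "F ((a + b) / 2) - g ((a + b) / 2) * ((b - a) / 2) \<le> F b"
      "F ((a + b) / 2) + g ((a + b) / 2) * ((b - a) / 2) \<le> F a"
      using sub[of "(a + b) / 2" b] sub[of "(a + b) / 2" a] by (simp_all add: field_simps)
    then show ?thesis by (simp add: field_simps)
  qed
  note sq = C1c_test_square_integrable[OF \<Omega>]
  have Fi: "integrable ?M (\<lambda>x. f x * F (\<phi> x))" if t: "C1c_test \<Omega> \<phi> D" for \<phi> D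
  proof -
    note [measurable] = C1c_test_measurable[OF t]
    obtain B where B: "\<And>x. \<bar>\<phi> x\<bar> \<le> B" using C1c_test_bounded[OF t] by blast
    have "\<bar>F (\<phi> x)\<bar> \<le> F (- B)" for x
      using B[of x] F0[of "\<phi> x"] by (simp add: Fanti abs_le_iff)
    then show ?thesis by (intro integrable_mult_bounded[OF f, where B = "F (- B)"]) auto
  qed
  define J where "J \<phi> D = sq_norm ?M D / 2 + (LINT x|?M. f x * F (\<phi> x))" for \<phi> :: "'a \<Rightarrow> real" and D :: "'a \<Rightarrow> 'a"
  define S where "S = {J \<phi> D |\<phi> D. C1c_test \<Omega> \<phi> D}"
  define m where "m = Inf S"
  have "0 \<le> J \<phi> D" for \<phi> D
  proof -
    have "0 \<le> (LINT x|?M. f x * F (\<phi> x))"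
      using f0 by (intro integral_nonneg_AE) (auto elim!: eventually_mono simp: F0)
    then show ?thesis using sq_norm_nonneg[of ?M D] by (simp add: J_def)
  qed
  then have bdd: "bdd_below S" by (auto simp: S_def intro!: bdd_belowI[of _ 0])
  have ne: "S \<noteq> {}" using C1c_test_zero by (auto simp: S_def)
  have mle: "m \<le> J \<phi> D" if "C1c_test \<Omega> \<phi> D" for \<phi> D
    unfolding m_def using that by (intro cInf_lower bdd) (auto simp: S_def)
  define t where "t k = 1 / real (Suc k)" for k
  have t0: "0 < t k" for k by (simp add: t_def)
  have tlim: "t \<longlonglongrightarrow> 0" unfolding t_def[abs_def] by (rule tendsto_one_over_Suc)
  have "\<exists>\<phi> D. C1c_test \<Omega> \<phi> D \<and> J \<phi> D < m + (t k)\<^sup>2" for k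
    using cInf_lessD[OF ne, of "m + (t k)\<^sup>2"] t0[of k] by (auto simp: S_def m_def)
  then obtain \<phi> D where tst: "\<And>k. C1c_test \<Omega> (\<phi> k) (D k)" and Jk: "\<And>k. J (\<phi> k) (D k) < m + (t k)\<^sup>2"
    by metis
  note [measurable] = C1c_test_measurable[OF tst]
  have cauchyD: "sq_norm ?M (\<lambda>x. D j x - D k x) \<le> 4 * (t j)\<^sup>2 + 4 * (t k)\<^sup>2" for j k
  proof -
    let ?\<phi> = "\<lambda>x. 1/2 * \<phi> j x + 1/2 * \<phi> k x" and ?D = "\<lambda>x. (1/2) *\<^sub>R D j x + (1/2) *\<^sub>R D k x"
    note tm = C1c_test_add_scaleR[OF tst[of j] tst[of k], of "1/2" "1/2"]
    have "(LINT x|?M. f x * F (?\<phi> x)) \<le> (LINT x|?M. (f x * F (\<phi> j x) + f x * F (\<phi> k x)) / 2)"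
    proof (rule integral_mono_AE)
      show "AE x in ?M. f x * F (?\<phi> x) \<le> (f x * F (\<phi> j x) + f x * F (\<phi> k x)) / 2"
        using f0
      proof eventually_elim
        case (elim x)
        have "f x * F ((\<phi> j x + \<phi> k x) / 2) \<le> f x * ((F (\<phi> j x) + F (\<phi> k x)) / 2)"
          using elim by (intro mult_left_mono mid)
        then show ?case by (simp add: add_divide_distrib ring_distribs)
      qed
    qed (use Fi[OF tm] Fi[OF tst] in auto)
    then have Fm: "(LINT x|?M. f x * F (?\<phi> x)) \<le> ((LINT x|?M. f x * F (\<phi> j x)) + (LINT x|?M. f x * F (\<phi> k x))) / 2"
      using Fi[OF tst] by simp
    have "sq_norm ?M (\<lambda>x. (1/2) *\<^sub>R (D j x + 1 *\<^sub>R D k x))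
        = (sq_norm ?M (D j) + 2 * (LINT x|?M. D j x \<bullet> D k x) + sq_norm ?M (D k)) / 4"
      unfolding sq_norm_scaleR sq_norm_add_scaleR[OF sq(2)[OF tst] sq(2)[OF tst]] by (simp add: power2_eq_square)
    then have Dp: "sq_norm ?M ?D = (sq_norm ?M (D j) + 2 * (LINT x|?M. D j x \<bullet> D k x) + sq_norm ?M (D k)) / 4"
      by (simp add: scaleR_add_right)
    have Dm: "sq_norm ?M (\<lambda>x. D j x - D k x) = sq_norm ?M (D j) - 2 * (LINT x|?M. D j x \<bullet> D k x) + sq_norm ?M (D k)"
      using sq_norm_add_scaleR[OF sq(2)[OF tst[of j]] sq(2)[OF tst[of k]], of "-1"] by simp
    \<comment> \<open>The midpoint competes for the infimum. By the parallelogram law its energy is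
      at most the mean of the two energies minus one eighth of the squared gradient distance. Since
      the mean exceeds \<open>m\<close> by at most half of
      \<open>(t j)\<^sup>2 + (t k)\<^sup>2\<close>, the constant 4 results.\<close>
    show ?thesis
      using mle[OF tm] Jk[of j] Jk[of k] Fm Dp Dm unfolding J_def by argo
  qed
  have a0: "(\<lambda>k. c * (t k)\<^sup>2) \<longlonglongrightarrow> 0" for c
  proof -
    have "(\<lambda>k. c * (t k)\<^sup>2) \<longlonglongrightarrow> c * 0\<^sup>2" by (intro tendsto_intros tlim)
    then show ?thesis by simp
  qed
  obtain K where K: "0 \<le> K" "\<And>\<phi> D. C1c_test \<Omega> \<phi> D \<Longrightarrow> sq_norm ?M \<phi> \<le> K * sq_norm ?M D"
    using Poincare_C1c[OF \<Omega>] by blast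
  have cauchy\<phi>: "sq_norm ?M (\<lambda>x. \<phi> j x - \<phi> k x) \<le> (4 * K) * (t j)\<^sup>2 + (4 * K) * (t k)\<^sup>2" for j k
  proof -
    have "C1c_test \<Omega> (\<lambda>x. \<phi> j x - \<phi> k x) (\<lambda>x. D j x - D k x)"
      using C1c_test_add_scaleR[OF tst[of j] tst[of k], of 1 "-1"] by simp
    then have "sq_norm ?M (\<lambda>x. \<phi> j x - \<phi> k x) \<le> K * sq_norm ?M (\<lambda>x. D j x - D k x)" by (rule K(2))
    also have "\<dots> \<le> K * (4 * (t j)\<^sup>2 + 4 * (t k)\<^sup>2)" by (intro mult_left_mono cauchyD K)
    finally show ?thesis by (simp add: algebra_simps)
  qed
  obtain G where G: "square_integrable ?M G" "(\<lambda>k. sq_norm ?M (\<lambda>x. D k x - G x)) \<longlonglongrightarrow> 0"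
    using L2_complete[OF sq(2)[OF tst] cauchyD a0] .
  obtain v where v: "square_integrable ?M v" "(\<lambda>k. sq_norm ?M (\<lambda>x. \<phi> k x - v x)) \<longlonglongrightarrow> 0"
    using L2_complete[OF sq(1)[OF tst] cauchy\<phi> a0] .
  have H: "H10 \<Omega> v G" unfolding H10_iff using v G tst by blast
  obtain r where r: "strict_mono r" "AE x in ?M. (\<lambda>k. \<phi> (r k) x) \<longlonglongrightarrow> v x"
    using AE_subseq_of_sq_norm[OF sq(1)[OF tst] v] .
  note [measurable] = square_integrableD(1)[OF v(1)]
  have le: "(LINT x|?M. f x * g (v x) * \<psi> x) \<le> (LINT x|?M. G x \<bullet> P x)" if tp: "C1c_test \<Omega> \<psi> P" for \<psi> P
  proof -
    note [measurable] = C1c_test_measurable[OF tp]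
    obtain B where B: "\<And>x. \<bar>\<psi> x\<bar> \<le> B" "0 \<le> B" using C1c_test_bounded[OF tp] by blast
    have gB: "\<bar>g s * \<psi> x\<bar> \<le> B" for s x
      using mult_mono[of "\<bar>g s\<bar>" 1 "\<bar>\<psi> x\<bar>" B] g0[of s] g1[of s] B by (simp add: abs_mult)
    have step: "(LINT x|?M. f x * (g (\<phi> k x + t k * \<psi> x) * \<psi> x))
        \<le> (LINT x|?M. P x \<bullet> D k x) + t k * (sq_norm ?M P / 2 + 1)" for k
    proof -
      have tk: "C1c_test \<Omega> (\<lambda>x. \<phi> k x + t k * \<psi> x) (\<lambda>x. D k x + t k *\<^sub>R P x)"
        using C1c_test_add_scaleR[OF tst[of k] tp, of 1 "t k"] by simp
      let ?I = "LINT x|?M. f x * (g (\<phi> k x + t k * \<psi> x) * \<psi> x)"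
      have gi: "integrable ?M (\<lambda>x. f x * (g (\<phi> k x + t k * \<psi> x) * \<psi> x))"
        by (rule integrable_mult_bounded[OF f, where B = B]) (auto simp: gB)
      \<comment> \<open>The subgradient is taken at the perturbed point and compared with the
        unperturbed one. This puts \<open>g\<close> at \<open>\<phi> k x + t k * \<psi> x\<close>,
        and continuity of \<open>g\<close> removes the shift in the limit.\<close>
      have "(LINT x|?M. f x * F (\<phi> k x + t k * \<psi> x) + t k * (f x * (g (\<phi> k x + t k * \<psi> x) * \<psi> x)))
          \<le> (LINT x|?M. f x * F (\<phi> k x))"
      proof (rule integral_mono_AE)
        show "AE x in ?M. f x * F (\<phi> k x + t k * \<psi> x) + t k * (f x * (g (\<phi> k x + t k * \<psi> x) * \<psi> x)) \<le> f x * F (\<phi> k x)"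
          using f0
        proof eventually_elim
          case (elim x)
          have "f x * (F (\<phi> k x + t k * \<psi> x) + t k * g (\<phi> k x + t k * \<psi> x) * \<psi> x) \<le> f x * F (\<phi> k x)"
            using elim sub[of "\<phi> k x + t k * \<psi> x" "\<phi> k x"] by (intro mult_left_mono) (auto simp: algebra_simps)
          then show ?case by (simp add: algebra_simps)
        qed
      qed (use Fi[OF tk] gi Fi[OF tst] in auto)
      then have 1: "(LINT x|?M. f x * F (\<phi> k x + t k * \<psi> x)) + t k * ?I \<le> (LINT x|?M. f x * F (\<phi> k x))"
        using Fi[OF tk] gi by simp
      have 2: "sq_norm ?M (\<lambda>x. D k x + t k *\<^sub>R P x) = sq_norm ?M (D k) + 2 * t k * (LINT x|?M. P x \<bullet> D k x) + (t k)\<^sup>2 * sq_norm ?M P"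
        using sq_norm_add_scaleR[OF sq(2)[OF tst[of k]] sq(2)[OF tp], of "t k"] by (simp add: inner_commute)
      \<comment> \<open>After division by the step \<open>t k\<close>, the quadratic term and the
        energy defect both leave a multiple of \<open>t k\<close>. This is why the defect was chosen
        as the square of the step.\<close>
      have "t k * ?I \<le> t k * (LINT x|?M. P x \<bullet> D k x) + (t k)\<^sup>2 * sq_norm ?M P / 2 + (t k)\<^sup>2"
        using mle[OF tk] Jk[of k] 1 2 unfolding J_def by argo
      also have "\<dots> = t k * ((LINT x|?M. P x \<bullet> D k x) + t k * (sq_norm ?M P / 2 + 1))"
        by (simp add: power2_eq_square algebra_simps)
      finally show ?thesis using t0[of k] by simp
    qed
    have lim1: "(\<lambda>k. LINT x|?M. f x * (g (\<phi> (r k) x + t (r k) * \<psi> x) * \<psi> x)) \<longlonglongrightarrow> (LINT x|?M. f x * (g (v x) * \<psi> x))"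
    proof (rule integral_dominated_convergence[where w = "\<lambda>x. B * \<bar>f x\<bar>"])
      show "AE x in ?M. (\<lambda>k. f x * (g (\<phi> (r k) x + t (r k) * \<psi> x) * \<psi> x)) \<longlonglongrightarrow> f x * (g (v x) * \<psi> x)"
        using r(2)
      proof eventually_elim
        case (elim x)
        have "(\<lambda>k. \<phi> (r k) x + t (r k) * \<psi> x) \<longlonglongrightarrow> v x + 0 * \<psi> x"
          by (intro tendsto_intros elim LIMSEQ_subseq_LIMSEQ[OF tlim r(1), unfolded o_def])
        then have "(\<lambda>k. g (\<phi> (r k) x + t (r k) * \<psi> x)) \<longlonglongrightarrow> g (v x)"
          using cont by (intro isCont_tendsto_compose[of "v x" g]) (auto simp: continuous_on_eq_continuous_at)
        then show ?case by (intro tendsto_intros)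
      qed
      show "AE x in ?M. norm (f x * (g (\<phi> (r k) x + t (r k) * \<psi> x) * \<psi> x)) \<le> B * \<bar>f x\<bar>" for k
      proof (rule AE_I2)
        fix x
        have "\<bar>g (\<phi> (r k) x + t (r k) * \<psi> x) * \<psi> x\<bar> * \<bar>f x\<bar> \<le> B * \<bar>f x\<bar>" by (intro mult_right_mono gB) simp
        then show "norm (f x * (g (\<phi> (r k) x + t (r k) * \<psi> x) * \<psi> x)) \<le> B * \<bar>f x\<bar>" by (simp add: abs_mult mult_ac)
      qed
    qed (use f in auto)
    have "(\<lambda>k. LINT x|?M. P x \<bullet> D k x) \<longlonglongrightarrow> (LINT x|?M. P x \<bullet> G x)"
      by (rule tendsto_integral_inner[OF sq(2)[OF tp] sq(2)[OF tst] G])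
    then have "(\<lambda>k. (LINT x|?M. P x \<bullet> D k x) + t k * (sq_norm ?M P / 2 + 1)) \<longlonglongrightarrow> (LINT x|?M. P x \<bullet> G x) + 0 * (sq_norm ?M P / 2 + 1)"
      by (intro tendsto_intros tlim)
    from LIMSEQ_subseq_LIMSEQ[OF this r(1)] have lim2:
      "(\<lambda>k. (LINT x|?M. P x \<bullet> D (r k) x) + t (r k) * (sq_norm ?M P / 2 + 1)) \<longlonglongrightarrow> (LINT x|?M. P x \<bullet> G x)"
      by (simp add: o_def)
    have "(LINT x|?M. f x * (g (v x) * \<psi> x)) \<le> (LINT x|?M. P x \<bullet> G x)"
      by (rule LIMSEQ_le[OF lim1 lim2]) (use step in auto)
    then show ?thesis by (simp add: inner_commute mult.assoc)
  qed
  have "(LINT x|?M. G x \<bullet> P x) = (LINT x|?M. f x * g (v x) * \<psi> x)" if tp: "C1c_test \<Omega> \<psi> P" for \<psi> P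
  proof -
    have "C1c_test \<Omega> (\<lambda>x. - \<psi> x) (\<lambda>x. - P x)"
      using C1c_test_add_scaleR[OF tp C1c_test_zero, of "-1" 0] by simp
    from le[OF this] le[OF tp] show ?thesis by simp
  qed
  then show ?thesis using H by blast
qed

text \<open>The smoothed absolute value is \<open>sqrt (\<epsilon>\<^sup>2 + \<psi>\<^sup>2) - \<epsilon>\<close>; no Sobolev embedding is involved.\<close>

lemma weak_equation_extends:
  fixes \<Omega> :: "'a::euclidean_space set" and u :: "'a \<Rightarrow> real"
  assumes \<Omega>: "open \<Omega>" "bounded \<Omega>" and u: "integrable (lebesgue_on \<Omega>) u"
    and u0: "AE x in lebesgue_on \<Omega>. 0 \<le> u x"
    and G: "square_integrable (lebesgue_on \<Omega>) G"
    and eq: "\<And>\<psi> P. C1c_test \<Omega> \<psi> P \<Longrightarrow>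
      (LINT x|lebesgue_on \<Omega>. G x \<bullet> P x) = (LINT x|lebesgue_on \<Omega>. u x * \<psi> x)"
    and H: "H10 \<Omega> \<phi> D"
  shows "integrable (lebesgue_on \<Omega>) (\<lambda>x. u x * \<phi> x)"
    "(LINT x|lebesgue_on \<Omega>. G x \<bullet> D x) = (LINT x|lebesgue_on \<Omega>. u x * \<phi> x)"
proof -
  let ?M = "lebesgue_on \<Omega>"
  note sq = C1c_test_square_integrable[OF \<Omega>]
  have [measurable]: "u \<in> borel_measurable ?M" using u by auto
  have ui: "integrable ?M (\<lambda>x. u x * \<psi> x)" if t: "C1c_test \<Omega> \<psi> P" for \<psi> P
  proof -
    obtain B where "\<And>x. \<bar>\<psi> x\<bar> \<le> B" using C1c_test_bounded[OF t] by blast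
    then show ?thesis
      using C1c_test_measurable[OF t] by (intro integrable_mult_bounded[OF u, where B = B]) auto
  qed
  have uai: "integrable ?M (\<lambda>x. u x * \<bar>\<psi> x\<bar>)" if t: "C1c_test \<Omega> \<psi> P" for \<psi> P
  proof -
    obtain B where "\<And>x. \<bar>\<psi> x\<bar> \<le> B" using C1c_test_bounded[OF t] by blast
    then show ?thesis
      using C1c_test_measurable[OF t] by (intro integrable_mult_bounded[OF u, where B = B]) auto
  qed
  have abs_bound: "(LINT x|?M. u x * \<bar>\<psi> x\<bar>) \<le> sqrt (sq_norm ?M G) * sqrt (sq_norm ?M P)"
    if t: "C1c_test \<Omega> \<psi> P" for \<psi> P
  proof -
    note [measurable] = C1c_test_measurable[OF t]
    define \<epsilon> where "\<epsilon> n = 1 / real (Suc n)" for n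
    have e0: "0 < \<epsilon> n" for n by (simp add: \<epsilon>_def)
    have elim: "\<epsilon> \<longlonglongrightarrow> 0" unfolding \<epsilon>_def[abs_def] by (rule tendsto_one_over_Suc)
    define \<theta> where "\<theta> n s = sqrt ((\<epsilon> n)\<^sup>2 + s\<^sup>2) - \<epsilon> n" for n s
    define \<theta>' where "\<theta>' n s = s / sqrt ((\<epsilon> n)\<^sup>2 + s\<^sup>2)" for n s
    have pos: "0 < (\<epsilon> n)\<^sup>2 + s\<^sup>2" for n s using e0[of n] by (simp add: add_pos_nonneg)
    have d: "(\<theta> n has_field_derivative \<theta>' n s) (at s)" for n s
      unfolding \<theta>_def[abs_def] \<theta>'_def using pos[of n s]
      by (auto intro!: derivative_eq_intros simp: field_simps)
    have c: "continuous_on UNIV (\<theta>' n)" for n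
      unfolding \<theta>'_def[abs_def] using e0[of n] by (intro continuous_intros) auto
    have z: "\<theta> n 0 = 0" for n using e0[of n] by (simp add: \<theta>_def)
    have b: "\<bar>\<theta>' n s\<bar> \<le> 1" for n s
    proof -
      have "\<bar>s\<bar> \<le> sqrt ((\<epsilon> n)\<^sup>2 + s\<^sup>2)" by (rule real_le_rsqrt) simp
      then show ?thesis using pos[of n s] by (simp add: \<theta>'_def)
    qed
    have tb: "\<bar>\<theta> n s\<bar> \<le> \<bar>s\<bar>" for n s
    proof -
      have "\<epsilon> n \<le> sqrt ((\<epsilon> n)\<^sup>2 + s\<^sup>2)" by (rule real_le_rsqrt) simp
      moreover have "sqrt ((\<epsilon> n)\<^sup>2 + s\<^sup>2) \<le> \<epsilon> n + \<bar>s\<bar>"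
        using e0[of n] by (intro real_le_lsqrt) (auto simp: power2_sum)
      ultimately show ?thesis by (simp add: \<theta>_def)
    qed
    note tt = C1c_test_compose[OF t d c z]
    have "(\<lambda>n. LINT x|?M. u x * \<theta> n (\<psi> x)) \<longlonglongrightarrow> (LINT x|?M. u x * \<bar>\<psi> x\<bar>)"
    proof (rule integral_dominated_convergence[where w = "\<lambda>x. \<bar>u x * \<bar>\<psi> x\<bar>\<bar>"])
      show "AE x in ?M. (\<lambda>n. u x * \<theta> n (\<psi> x)) \<longlonglongrightarrow> u x * \<bar>\<psi> x\<bar>"
      proof (rule AE_I2)
        fix x
        have "(\<lambda>n. u x * \<theta> n (\<psi> x)) \<longlonglongrightarrow> u x * (sqrt (0\<^sup>2 + (\<psi> x)\<^sup>2) - 0)"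
          unfolding \<theta>_def by (intro tendsto_intros elim)
        then show "(\<lambda>n. u x * \<theta> n (\<psi> x)) \<longlonglongrightarrow> u x * \<bar>\<psi> x\<bar>" by simp
      qed
      show "AE x in ?M. norm (u x * \<theta> n (\<psi> x)) \<le> \<bar>u x * \<bar>\<psi> x\<bar>\<bar>" for n
        using tb by (intro AE_I2) (simp add: abs_mult mult_left_mono)
      show "(\<lambda>x. u x * \<theta> n (\<psi> x)) \<in> borel_measurable ?M" for n
        using ui[OF tt] by auto
    qed (use uai[OF t] in auto)
    \<comment> \<open>The equation is applied to the smoothed function, whose gradient is pointwise
      no longer than \<open>P\<close> because \<open>|\<theta>' n| <= 1\<close>. The bound is thus
      uniform in \<open>n\<close> and survives the limit.\<close>
    moreover have "(LINT x|?M. u x * \<theta> n (\<psi> x)) \<le> sqrt (sq_norm ?M G) * sqrt (sq_norm ?M P)" for n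
    proof -
      have "(LINT x|?M. u x * \<theta> n (\<psi> x)) = (LINT x|?M. G x \<bullet> (\<theta>' n (\<psi> x) *\<^sub>R P x))"
        by (rule eq[OF tt, symmetric])
      also have "\<dots> \<le> sqrt (sq_norm ?M G) * sqrt (sq_norm ?M (\<lambda>x. \<theta>' n (\<psi> x) *\<^sub>R P x))"
        using abs_integral_inner_le[OF G sq(2)[OF tt[of n]]] by linarith
      also have "\<dots> \<le> sqrt (sq_norm ?M G) * sqrt (sq_norm ?M P)"
      proof (intro mult_left_mono real_sqrt_le_mono)
        show "sq_norm ?M (\<lambda>x. \<theta>' n (\<psi> x) *\<^sub>R P x) \<le> sq_norm ?M P"
          unfolding sq_norm_def using sq(2)[OF tt[of n]] sq(2)[OF t] b[of n]
          by (intro integral_mono) (auto simp: square_integrable_def power_mult_distrib abs_square_le_1 intro!: mult_left_le_one_le)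
      qed (simp add: sq_norm_nonneg)
      finally show ?thesis .
    qed
    ultimately show ?thesis by (auto intro: LIMSEQ_le_const2)
  qed
  obtain \<phi>s Ds where v: "square_integrable ?M \<phi>" "square_integrable ?M D" and t: "\<And>k. C1c_test \<Omega> (\<phi>s k) (Ds k)"
    and 1: "(\<lambda>k. sq_norm ?M (\<lambda>x. \<phi>s k x - \<phi> x)) \<longlonglongrightarrow> 0" and 2: "(\<lambda>k. sq_norm ?M (\<lambda>x. Ds k x - D x)) \<longlonglongrightarrow> 0"
    using H by (auto simp: H10_iff)
  note [measurable] = C1c_test_measurable[OF t] square_integrableD(1)[OF v(1)]
  obtain r where r: "strict_mono r" "AE x in ?M. (\<lambda>k. \<phi>s (r k) x) \<longlonglongrightarrow> \<phi> x"
    using AE_subseq_of_sq_norm[OF sq(1)[OF t] v(1) 1] .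
  \<comment> \<open>\<open>A k\<close> is the limit in \<open>j\<close> of the bound for
    \<open>\<phi>s k - \<phi>s (r j)\<close>: the squared distance between the two gradients is at
    most twice the sum of their squared distances to \<open>D\<close>, and the second of these
    vanishes. Fatou in \<open>j\<close> transfers the bound to
    \<open>\<phi>s k - \<phi>\<close>.\<close>
  define A where "A k = sqrt (sq_norm ?M G) * sqrt (2 * sq_norm ?M (\<lambda>x. Ds k x - D x))" for k
  have fat: "integrable ?M (\<lambda>x. u x * \<bar>\<phi>s k x - \<phi> x\<bar>) \<and> (LINT x|?M. u x * \<bar>\<phi>s k x - \<phi> x\<bar>) \<le> A k" for k
  proof -
    define c where "c j = sqrt (sq_norm ?M G) * sqrt (2 * sq_norm ?M (\<lambda>x. Ds k x - D x) + 2 * sq_norm ?M (\<lambda>x. Ds (r j) x - D x))" for j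
    have td: "C1c_test \<Omega> (\<lambda>x. \<phi>s k x - \<phi>s (r j) x) (\<lambda>x. Ds k x - Ds (r j) x)" for j
      using C1c_test_add_scaleR[OF t[of k] t[of "r j"], of 1 "-1"] by simp
    have "c \<longlonglongrightarrow> sqrt (sq_norm ?M G) * sqrt (2 * sq_norm ?M (\<lambda>x. Ds k x - D x) + 2 * 0)"
      unfolding c_def[abs_def] by (intro tendsto_intros LIMSEQ_subseq_LIMSEQ[OF 2 r(1), unfolded o_def])
    then have cA: "c \<longlonglongrightarrow> A k" by (simp add: A_def)
    have lim: "AE x in ?M. (\<lambda>j. u x * \<bar>\<phi>s k x - \<phi>s (r j) x\<bar>) \<longlonglongrightarrow> u x * \<bar>\<phi>s k x - \<phi> x\<bar>"
      using r(2) by eventually_elim (intro tendsto_intros)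
    have "(LINT x|?M. u x * \<bar>\<phi>s k x - \<phi>s (r j) x\<bar>) \<le> c j" for j
    proof -
      have "sq_norm ?M (\<lambda>x. Ds k x - Ds (r j) x) \<le> 2 * sq_norm ?M (\<lambda>x. Ds k x - D x) + 2 * sq_norm ?M (\<lambda>x. Ds (r j) x - D x)"
        using sq_norm_diff_le[OF square_integrable_diff[OF sq(2)[OF t[of k]] v(2)] square_integrable_diff[OF sq(2)[OF t[of "r j"]] v(2)]]
        by simp
      then have "sqrt (sq_norm ?M G) * sqrt (sq_norm ?M (\<lambda>x. Ds k x - Ds (r j) x)) \<le> c j"
        unfolding c_def by (intro mult_left_mono real_sqrt_le_mono) (auto simp: sq_norm_nonneg)
      then show ?thesis using abs_bound[OF td[of j]] by linarith
    qed
    note Fat = Fatou_integrable[OF uai[OF td] _ _ lim this cA]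
    show ?thesis using u0 by (intro conjI Fat) (auto elim!: eventually_mono)
  qed
  have di: "integrable ?M (\<lambda>x. u x * (\<phi>s k x - \<phi> x))" for k
    by (rule Bochner_Integration.integrable_bound[OF conjunct1[OF fat[of k]]]) (auto simp: abs_mult)
  \<comment> \<open>With \<open>u\<close> only integrable and \<open>\<phi>\<close> possibly
    unbounded, integrability is reached by writing \<open>\<phi>\<close> as a bounded test function
    minus a difference that \<open>fat\<close> controls.\<close>
  show ui\<phi>: "integrable ?M (\<lambda>x. u x * \<phi> x)"
    using Bochner_Integration.integrable_diff[OF ui[OF t[of 0]] di[of 0]] by (simp add: algebra_simps)
  have A0: "A \<longlonglongrightarrow> 0"
  proof -
    have "A \<longlonglongrightarrow> sqrt (sq_norm ?M G) * sqrt (2 * 0)"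
      unfolding A_def[abs_def] by (intro tendsto_intros 2)
    then show ?thesis by simp
  qed
  have "(\<lambda>k. (LINT x|?M. u x * \<phi>s k x) - (LINT x|?M. u x * \<phi> x)) \<longlonglongrightarrow> 0"
  proof (rule Lim_null_comparison[OF always_eventually A0], rule allI)
    fix k
    have "norm ((LINT x|?M. u x * \<phi>s k x) - (LINT x|?M. u x * \<phi> x)) = norm (LINT x|?M. u x * (\<phi>s k x - \<phi> x))"
      using ui[OF t[of k]] ui\<phi> by (simp add: right_diff_distrib)
    also have "\<dots> \<le> (LINT x|?M. norm (u x * (\<phi>s k x - \<phi> x)))" by (rule integral_norm_bound)
    also have "\<dots> = (LINT x|?M. u x * \<bar>\<phi>s k x - \<phi> x\<bar>)"
      using u0 by (intro integral_cong_AE) (auto elim!: eventually_mono simp: abs_mult)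
    also have "\<dots> \<le> A k" using fat by blast
    finally show "norm ((LINT x|?M. u x * \<phi>s k x) - (LINT x|?M. u x * \<phi> x)) \<le> A k" .
  qed
  then have l1: "(\<lambda>k. LINT x|?M. u x * \<phi>s k x) \<longlonglongrightarrow> (LINT x|?M. u x * \<phi> x)" by (simp add: LIM_zero_iff)
  have l2: "(\<lambda>k. LINT x|?M. G x \<bullet> Ds k x) \<longlonglongrightarrow> (LINT x|?M. G x \<bullet> D x)"
    by (rule tendsto_integral_inner[OF G sq(2)[OF t] v(2) 2])
  show "(LINT x|?M. G x \<bullet> D x) = (LINT x|?M. u x * \<phi> x)"
    using LIMSEQ_unique[OF l2] l1 by (simp add: eq[OF t])
qed

section \<open>The nonlinearity\<close>

lemma integral_Icc_diff:
  fixes e :: "real \<Rightarrow> real"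
  assumes "e integrable_on {0..b}" "0 \<le> a" "a \<le> b"
  shows "integral {0..b} e - integral {0..a} e = integral {a..b} e"
  using Henstock_Kurzweil_Integration.integral_combine[OF assms(2,3,1)] by simp

text \<open>Near \<open>\<sigma>\<close> the product in \<open>lim\<close> exceeds
  \<open>C / 2\<close>, and \<open>(\<sigma> - s) powr \<gamma> <= \<sigma> - s\<close> once
  \<open>\<sigma> - s <= 1\<close>. So \<open>h\<close> dominates a multiple of
  \<open>1 / (\<sigma> - s)\<close>, whose integral diverges logarithmically.\<close>

lemma filterlim_Hf_at_top:
  fixes h :: "real \<Rightarrow> real"
  assumes \<sigma>: "0 < \<sigma>" and cont: "continuous_on {0..<\<sigma>} h" and \<gamma>: "1 \<le> \<gamma>" and C: "0 < C"
    and lim: "((\<lambda>s. (\<sigma> - s) powr \<gamma> * h s) \<longlongrightarrow> C) (at_left \<sigma>)"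
  shows "filterlim (Hf h) at_top (at_left \<sigma>)"
proof -
  have "\<forall>\<^sub>F s in at_left \<sigma>. C / 2 < (\<sigma> - s) powr \<gamma> * h s"
    using lim by (rule order_tendstoD) (use C in simp)
  then obtain b where b: "b < \<sigma>" "\<And>s. b < s \<Longrightarrow> s < \<sigma> \<Longrightarrow> C / 2 < (\<sigma> - s) powr \<gamma> * h s"
    by (auto simp: eventually_at_left_field)
  \<comment> \<open>Three demands at once: \<open>a > b\<close>, so the lower bound on the product
    holds from \<open>a\<close> itself on; \<open>a >= 0\<close>, so integrals stay in the domain of
    \<open>h\<close>; and \<open>\<sigma> - a <= 1\<close>, so that raising the exponent to
    \<open>\<gamma>\<close> decreases the power.\<close>
  define a where "a = max ((b + \<sigma>) / 2) (max 0 (\<sigma> - 1))"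
  have a: "0 \<le> a" "a < \<sigma>" "b < a" "\<sigma> - 1 \<le> a" using b(1) \<sigma> by (auto simp: a_def less_max_iff_disj)
  have lower: "C / 2 * (1 / (\<sigma> - s)) \<le> h s" if "a \<le> s" "s < \<sigma>" for s
  proof -
    have "C / 2 < (\<sigma> - s) powr \<gamma> * h s" using b(2)[of s] that a by linarith
    moreover have "0 < h s"
      using calculation C by (smt (verit) half_gt_zero powr_ge_zero zero_less_mult_iff)
    moreover have "(\<sigma> - s) powr \<gamma> \<le> (\<sigma> - s) powr 1"
      using that a \<gamma> by (intro powr_mono') auto
    ultimately have "C / 2 < (\<sigma> - s) * h s"
      using that by (smt (verit) mult_right_mono powr_one)
    then show ?thesis using that by (simp add: field_simps)
  qed
  have bound: "Hf h a + C / 2 * (ln (\<sigma> - a) - ln (\<sigma> - s)) \<le> Hf h s" if s: "a \<le> s" "s < \<sigma>" for s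
  proof -
    have "((\<lambda>t. C / 2 * (1 / (\<sigma> - t))) has_integral (- (C / 2) * ln (\<sigma> - s)) - (- (C / 2) * ln (\<sigma> - a))) {a..s}"
      using s by (intro fundamental_theorem_of_calculus)
        (auto intro!: derivative_eq_intros simp flip: has_real_derivative_iff_has_vector_derivative simp: field_simps)
    moreover have hint: "h integrable_on {a..s}" "h integrable_on {0..s}"
      using s a by (auto intro!: integrable_continuous_real continuous_on_subset[OF cont])
    ultimately have "(- (C / 2) * ln (\<sigma> - s)) - (- (C / 2) * ln (\<sigma> - a)) \<le> integral {a..s} h"
      using lower s by (intro has_integral_le[OF _ integrable_integral]) auto
    also have "\<dots> = Hf h s - Hf h a"
      unfolding Hf_def using integral_Icc_diff[OF hint(2) a(1) s(1)] by simp
    finally show ?thesis by (simp add: algebra_simps)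
  qed
  have "filterlim (\<lambda>s. \<sigma> - s) (at_right 0) (at_left \<sigma>)"
    unfolding filterlim_at by (auto intro!: tendsto_eq_intros simp: eventually_at_filter)
  then have "filterlim (\<lambda>s. ln (\<sigma> - s)) at_bot (at_left \<sigma>)"
    by (rule filterlim_compose[OF ln_at_0])
  then have "filterlim (\<lambda>s. - ln (\<sigma> - s)) at_top (at_left \<sigma>)"
    by (simp add: filterlim_uminus_at_top)
  then have "filterlim (\<lambda>s. C / 2 * (ln (\<sigma> - a) + - ln (\<sigma> - s))) at_top (at_left \<sigma>)"
    using C by (intro filterlim_tendsto_pos_mult_at_top[OF tendsto_const]
      filterlim_tendsto_add_at_top[OF tendsto_const]) auto
  then have "filterlim (\<lambda>s. Hf h a + C / 2 * (ln (\<sigma> - a) + - ln (\<sigma> - s))) at_top (at_left \<sigma>)"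
    by (intro filterlim_tendsto_add_at_top[OF tendsto_const])
  then show ?thesis
  proof (rule filterlim_at_top_mono)
    show "\<forall>\<^sub>F s in at_left \<sigma>. Hf h a + C / 2 * (ln (\<sigma> - a) + - ln (\<sigma> - s)) \<le> Hf h s"
      unfolding eventually_at_left_field using a bound by (intro exI[of _ a]) auto
  qed
qed

text \<open>Here \<open>gf\<close> is evaluated at \<open>max 0 s\<close> because it has no meaning at negative arguments.\<close>

lemma gf_regular:
  fixes h :: "real \<Rightarrow> real" and \<sigma> :: real
  defines "g \<equiv> \<lambda>s. gf h \<sigma> (max 0 s)"
  assumes \<sigma>: "0 < \<sigma>" and cont: "continuous_on {0..<\<sigma>} h" and nonneg: "\<forall>s\<in>{0..<\<sigma>}. 0 \<le> h s"
    and inf: "filterlim (Hf h) at_top (at_left \<sigma>)"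
  shows "0 \<le> Lval h \<sigma>" "continuous_on UNIV g" "antimono g"
    "\<And>s. 0 \<le> g s" "\<And>s. g s \<le> 1" "\<And>s. Lval h \<sigma> \<le> s \<Longrightarrow> g s = 0"
    "gf h \<sigma> \<in> borel_measurable borel"
proof -
  \<comment> \<open>Setting the integrand to 0 from \<open>\<sigma>\<close> on is a continuous
    extension up to \<open>\<sigma>\<close> exactly because \<open>Hf h\<close> diverges there. Its
    primitive \<open>\<Psi>\<close> is then a continuous bijection from the compact interval
    \<open>{0..\<sigma>}\<close> onto \<open>{0..Lval h \<sigma>}\<close>, so continuity of the
    inverse comes from compactness.\<close>
  define e where "e t = (if t < \<sigma> then exp (- Hf h t) else 0)" for t
  define \<Psi> where "\<Psi> s = integral {0..s} e" for s
  have hint: "h integrable_on {a..b}" if "0 \<le> a" "b < \<sigma>" for a b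
    using that by (auto intro!: integrable_continuous_real continuous_on_subset[OF cont])
  have Hmono: "Hf h a \<le> Hf h b" if "0 \<le> a" "a \<le> b" "b < \<sigma>" for a b
  proof -
    have "0 \<le> integral {a..b} h" using that nonneg by (intro integral_nonneg hint) auto
    then show ?thesis
      unfolding Hf_def using integral_Icc_diff[of h b a] hint[of 0 b] that by simp
  qed
  have H0: "0 \<le> Hf h t" if "0 \<le> t" "t < \<sigma>" for t using Hmono[of 0 t] that by (simp add: Hf_def)
  have e01: "0 \<le> e t" "t < \<sigma> \<Longrightarrow> 0 < e t" "0 \<le> t \<Longrightarrow> e t \<le> 1" for t using H0[of t] by (auto simp: e_def)
  have eanti: "e b \<le> e a" if "0 \<le> a" "a \<le> b" for a b using Hmono[of a b] that by (auto simp: e_def)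
  have econt: "continuous_on {0..\<sigma>} e"
    unfolding continuous_on_eq_continuous_within
  proof
    fix t assume t: "t \<in> {0..\<sigma>}"
    show "continuous (at t within {0..\<sigma>}) e"
    proof (cases "t = \<sigma>")
      case True
      have "((\<lambda>t. exp (- Hf h t)) \<longlongrightarrow> 0) (at_left \<sigma>)"
        using inf by (intro filterlim_compose[OF exp_at_bot]) (simp add: filterlim_uminus_at_top)
      then have "(e \<longlongrightarrow> 0) (at_left \<sigma>)"
        by (rule Lim_transform_eventually) (auto simp: e_def eventually_at_filter)
      then show ?thesis
        unfolding continuous_within True using \<sigma> by (simp add: at_within_Icc_at_left e_def)
    next
      case False
      define b where "b = (t + \<sigma>) / 2"
      have b: "t < b" "b < \<sigma>" "0 \<le> t" using False t by (auto simp: b_def)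
      have "continuous_on {0..b} (Hf h)"
        unfolding Hf_def using b by (intro indefinite_integral_continuous_1 hint) auto
      then have "continuous_on {0..b} (\<lambda>t. exp (- Hf h t))" by (intro continuous_intros)
      then have "continuous_on {0..b} e"
        by (rule continuous_on_eq) (use b in \<open>auto simp: e_def\<close>)
      then have "continuous (at t within {0..b}) e"
        using b by (auto simp: continuous_on_eq_continuous_within)
      moreover have "at t within {0..\<sigma>} = at t within {0..b}"
        using b by (intro at_within_nhd[of t "{..<b}"]) auto
      ultimately show ?thesis by simp
    qed
  qed
  have eint: "e integrable_on {a..b}" if "0 \<le> a" "b \<le> \<sigma>" for a b
    using that by (auto intro!: integrable_continuous_real continuous_on_subset[OF econt])
  have \<Psi>cont: "continuous_on {0..\<sigma>} \<Psi>"
    unfolding \<Psi>_def by (intro indefinite_integral_continuous_1 eint) auto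
  have \<Psi>less: "\<Psi> a < \<Psi> b" if "0 \<le> a" "a < b" "b \<le> \<sigma>" for a b
  proof -
    \<comment> \<open>The detour over the midpoint is due to \<open>b = \<sigma>\<close>, where
      \<open>e\<close> vanishes: at \<open>c < \<sigma>\<close> it is still positive, and being
      antitone it is at least \<open>e c\<close> on \<open>{a..c}\<close>.\<close>
    define c where "c = (a + b) / 2"
    have c: "a < c" "c < b" "c < \<sigma>" using that by (auto simp: c_def)
    have "0 < (c - a) * e c" using c e01(2)[of c] by simp
    also have "\<dots> = integral {a..c} (\<lambda>t. e c)" using c by simp
    also have "\<dots> \<le> integral {a..c} e" using that c eanti by (intro integral_le eint) auto
    also have "\<dots> \<le> integral {a..b} e"
      using that c e01(1) by (intro integral_subset_le eint) auto
    finally show ?thesis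
      unfolding \<Psi>_def using integral_Icc_diff[of e b a] eint[of 0 b] that by simp
  qed
  then have inj: "inj_on \<Psi> {0..\<sigma>}"
    by (intro linorder_inj_onI) (auto simp: less_imp_neq)
  have \<Psi>0: "\<Psi> 0 = 0" by (simp add: \<Psi>_def)
  have psi: "psi h t = \<Psi> t" if "t < \<sigma>" for t
    unfolding psi_def \<Psi>_def by (rule integral_cong) (use that in \<open>auto simp: e_def\<close>)
  have L: "Lval h \<sigma> = \<Psi> \<sigma>"
  proof -
    have "Lval h \<sigma> = integral {0..<\<sigma>} e"
      unfolding Lval_def by (rule integral_cong) (auto simp: e_def)
    also have "\<dots> = integral {0..\<sigma>} e"
      by (intro integral_spike_set) (auto intro!: negligible_subset[OF negligible_sing[of \<sigma>]])
    finally show ?thesis by (simp add: \<Psi>_def)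
  qed
  have L0: "0 < Lval h \<sigma>" using \<Psi>less[of 0 \<sigma>] \<sigma> by (simp add: L \<Psi>0)
  then show "0 \<le> Lval h \<sigma>" by simp
  define \<iota> where "\<iota> = the_inv_into {0..\<sigma>} \<Psi>"
  have \<iota>\<Psi>: "\<iota> (\<Psi> t) = t" if "t \<in> {0..\<sigma>}" for t
    unfolding \<iota>_def using inj that by (rule the_inv_into_f_f)
  have ex: "\<exists>t\<in>{0..\<sigma>}. \<Psi> t = s" if "s \<in> {0..Lval h \<sigma>}" for s
    using IVT'[of \<Psi> 0 s \<sigma>] that \<sigma> \<Psi>cont by (auto simp: \<Psi>0 L)
  have img: "\<Psi> ` {0..\<sigma>} = {0..Lval h \<sigma>}"
  proof
    show "\<Psi> ` {0..\<sigma>} \<subseteq> {0..Lval h \<sigma>}"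
      using \<Psi>less[of 0] \<Psi>less[of _ \<sigma>] \<Psi>0 L \<sigma> by (force simp: le_less)
    show "{0..Lval h \<sigma>} \<subseteq> \<Psi> ` {0..\<sigma>}" using ex by force
  qed
  have \<iota>cont: "continuous_on {0..Lval h \<sigma>} \<iota>"
    using continuous_on_inv[OF \<Psi>cont compact_Icc] \<iota>\<Psi> by (simp add: img)
  have \<iota>in: "\<iota> s \<in> {0..\<sigma>}" if "s \<in> {0..Lval h \<sigma>}" for s using ex[OF that] \<iota>\<Psi> by auto
  have \<iota>mono: "\<iota> s \<le> \<iota> s'" if "s \<in> {0..Lval h \<sigma>}" "s' \<in> {0..Lval h \<sigma>}" "s \<le> s'" for s s'
  proof -
    note ss = that
    obtain t where t: "t \<in> {0..\<sigma>}" "\<Psi> t = s" using ex[OF ss(1)] by blast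
    obtain t' where t': "t' \<in> {0..\<sigma>}" "\<Psi> t' = s'" using ex[OF ss(2)] by blast
    have "t \<le> t'" using \<Psi>less[of t' t] t t' ss(3) by force
    then show ?thesis using t t' \<iota>\<Psi> by auto
  qed
  \<comment> \<open>Clamping to \<open>{0..Lval h \<sigma>}\<close> expresses \<open>g\<close> on
    the whole line as one composition \<open>e (\<iota> (cl s))\<close>: left of 0 it gives the
    value at 0, beyond \<open>Lval h \<sigma>\<close> it gives \<open>e \<sigma> = 0\<close>.
    Continuity and monotonicity are then inherited from the three factors.\<close>
  define cl where "cl s = max 0 (min s (Lval h \<sigma>))" for s
  have clin: "cl s \<in> {0..Lval h \<sigma>}" for s using L0 by (auto simp: cl_def)
  have geq: "g s = e (\<iota> (cl s))" for s
  proof (cases "s < Lval h \<sigma>")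
    case True
    then have cl: "cl s = max 0 s" "cl s < Lval h \<sigma>" using L0 by (auto simp: cl_def)
    obtain t where t: "t \<in> {0..\<sigma>}" "\<Psi> t = cl s" using ex clin by blast
    then have "t < \<sigma>" using cl(2) L by (cases "t = \<sigma>") auto
    moreover have "inj_on (psi h) {0..<\<sigma>}"
    proof -
      have "inj_on \<Psi> {0..<\<sigma>}" by (rule inj_on_subset[OF inj]) auto
      then show ?thesis using psi inj_on_cong[of "{0..<\<sigma>}" "psi h" \<Psi>] by simp
    qed
    ultimately have "the_inv_into {0..<\<sigma>} (psi h) (cl s) = t"
      using the_inv_into_f_f[of "psi h" "{0..<\<sigma>}" t] psi[of t] t by simp
    then show ?thesis
      using cl \<iota>\<Psi>[OF t(1)] t(2) \<open>t < \<sigma>\<close> by (simp add: g_def gf_def e_def)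
  next
    case False
    then have "cl s = \<Psi> \<sigma>" using L0 L by (auto simp: cl_def)
    then have "\<iota> (cl s) = \<sigma>" using \<iota>\<Psi>[of \<sigma>] \<sigma> by simp
    then show ?thesis using False by (simp add: g_def gf_def e_def)
  qed
  show gcont: "continuous_on UNIV g"
    unfolding geq[abs_def]
  proof (intro continuous_on_compose2[OF econt] continuous_on_compose2[OF \<iota>cont])
    show "continuous_on UNIV cl" unfolding cl_def by (intro continuous_intros)
  qed (use \<iota>in clin in auto)
  show "antimono g"
  proof (rule antimonoI)
    fix s s' :: real assume "s \<le> s'"
    then have "cl s \<le> cl s'" by (auto simp: cl_def)
    then show "g s' \<le> g s" unfolding geq using \<iota>in[OF clin] \<iota>mono[OF clin clin] by (intro eanti) auto
  qed
  show "0 \<le> g s" "g s \<le> 1" for s unfolding geq using e01 \<iota>in[OF clin[of s]] by auto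
  show "g s = 0" if "Lval h \<sigma> \<le> s" for s using that by (simp add: g_def gf_def)
  \<comment> \<open>A negative number has no preimage under \<open>psi h\<close>, so the inverse is
    a definite description of nothing. Whatever its value, it is the same for all
    \<open>s < 0\<close>; hence \<open>gf h \<sigma>\<close> is constant there and measurable on the
    whole line, as required for composing it with functions that are nonnegative only almost
    everywhere.\<close>
  have neg: "gf h \<sigma> s = exp (- Hf h (THE x. False))" if "s < 0" for s
  proof -
    have "psi h x \<noteq> s" if "x \<in> {0..<\<sigma>}" for x
      using \<Psi>less[of 0 x] \<Psi>0 psi[of x] that \<open>s < 0\<close> by (cases "x = 0") auto
    then have "the_inv_into {0..<\<sigma>} (psi h) s = (THE x. False)"
      unfolding the_inv_into_def by (intro arg_cong[where f = The]) blast
    then show ?thesis using that L0 by (simp add: gf_def)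
  qed
  have "gf h \<sigma> = (\<lambda>s. if s < 0 then exp (- Hf h (THE x. False)) else g s)"
    using neg by (auto simp: fun_eq_iff g_def)
  moreover have [measurable]: "g \<in> borel_measurable borel"
    using gcont by (rule borel_measurable_continuous_onI)
  ultimately show "gf h \<sigma> \<in> borel_measurable borel" by simp
qed

section \<open>Truncation and the theorem\<close>

text \<open>The point 0 is the only delicate one; there the difference quotient is at most
  \<open>|y|\<close>. Squaring removes the kink of the positive part, and \<open>pos_trunc\<close>
  is built from this square.\<close>

lemma has_field_derivative_max_0_square:
  "((\<lambda>s. (max 0 s)\<^sup>2) has_field_derivative 2 * max 0 s) (at (s::real))"
proof -
  consider "s > 0" | "s < 0" | "s = 0" by linarith
  then show ?thesis
  proof cases
    case 1
    have "((\<lambda>s. s\<^sup>2) has_field_derivative 2 * max 0 s) (at s)"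
      using 1 by (auto intro!: derivative_eq_intros)
    then show ?thesis
      by (rule has_field_derivative_transform_within_open[where S = "{0<..}"]) (use 1 in auto)
  next
    case 2
    have "((\<lambda>s. 0) has_field_derivative 2 * max 0 s) (at s)" using 2 by simp
    then show ?thesis
      by (rule has_field_derivative_transform_within_open[where S = "{..<0}"]) (use 2 in auto)
  next
    case 3
    have "((\<lambda>y. (max 0 y)\<^sup>2 / y) \<longlongrightarrow> 0) (at (0::real))"
    proof (rule Lim_null_comparison[OF always_eventually])
      show "\<forall>y::real. norm ((max 0 y)\<^sup>2 / y) \<le> \<bar>y\<bar>" by (auto simp: max_def power2_eq_square)
      show "((\<lambda>y::real. \<bar>y\<bar>) \<longlongrightarrow> 0) (at 0)" by (auto intro!: tendsto_eq_intros)
    qed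
    then show ?thesis using 3 by (simp add: has_field_derivative_iff)
  qed
qed

text \<open>A \<open>C\<^sup>1\<close> substitute, with derivative in \<open>[0, 1)\<close>, for the positive part as a truncation.\<close>

definition pos_trunc :: "real \<Rightarrow> real" where
  "pos_trunc s = sqrt (1 + (max 0 s)\<^sup>2) - 1"

definition pos_trunc' :: "real \<Rightarrow> real" where
  "pos_trunc' s = max 0 s / sqrt (1 + (max 0 s)\<^sup>2)"

lemma pos_trunc_deriv: "(pos_trunc has_field_derivative pos_trunc' s) (at s)"
proof -
  have p: "0 < 1 + (max 0 s)\<^sup>2" by (simp add: add_pos_nonneg)
  have "((\<lambda>s. 1 + (max 0 s)\<^sup>2) has_field_derivative 0 + 2 * max 0 s) (at s)"
    by (intro DERIV_add DERIV_const has_field_derivative_max_0_square)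
  from DERIV_diff[OF DERIV_chain2[OF DERIV_real_sqrt[OF p] this] DERIV_const[of 1]] show ?thesis
    by (simp add: pos_trunc_def[abs_def] pos_trunc'_def field_simps)
qed

lemma pos_trunc'_bounds: "0 \<le> pos_trunc' s" "\<bar>pos_trunc' s\<bar> \<le> 1"
proof -
  have "max 0 s \<le> sqrt (1 + (max 0 s)\<^sup>2)" by (rule real_le_rsqrt) simp
  moreover have "0 < sqrt (1 + (max 0 s)\<^sup>2)" by (simp add: add_pos_nonneg)
  ultimately show "0 \<le> pos_trunc' s" "\<bar>pos_trunc' s\<bar> \<le> 1" by (auto simp: pos_trunc'_def)
qed

lemma continuous_on_pos_trunc': "continuous_on UNIV pos_trunc'"
  unfolding pos_trunc'_def[abs_def]
proof (intro continuous_intros ballI)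
  fix s :: real
  have "0 < 1 + (max 0 s)\<^sup>2" by (simp add: add_pos_nonneg)
  then show "sqrt (1 + (max 0 s)\<^sup>2) \<noteq> 0" by simp
qed

lemma pos_trunc_nonneg: "0 \<le> pos_trunc s"
  by (simp add: pos_trunc_def)

lemma pos_trunc_eq_0_iff: "pos_trunc s = 0 \<longleftrightarrow> s \<le> 0"
  by (auto simp: pos_trunc_def)

text \<open>The integrand is \<open>\<theta>' (v x) |G x|^2 >= 0\<close>, so a nonpositive integral
  forces it to vanish almost everywhere. Then \<open>\<theta>' (v x)\<close> or \<open>G x\<close>
  is zero, hence the gradient of the truncated function is zero.\<close>

lemma H10_truncation_zero:
  fixes \<Omega> :: "'a::euclidean_space set"
  assumes \<Omega>: "open \<Omega>" "bounded \<Omega>" and H: "H10 \<Omega> v G"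
    and \<theta>: "\<And>s. (\<theta> has_field_derivative \<theta>' s) (at s)" "continuous_on UNIV \<theta>'" "\<theta> 0 = 0" "\<And>s. \<bar>\<theta>' s\<bar> \<le> 1"
    and pos: "\<And>s. 0 \<le> \<theta>' s"
    and le: "(LINT x|lebesgue_on \<Omega>. G x \<bullet> (\<theta>' (v x) *\<^sub>R G x)) \<le> 0"
  shows "AE x in lebesgue_on \<Omega>. \<theta> (v x) = 0"
proof -
  let ?M = "lebesgue_on \<Omega>"
  have H\<theta>: "H10 \<Omega> (\<lambda>x. \<theta> (v x)) (\<lambda>x. \<theta>' (v x) *\<^sub>R G x)" by (rule H10_compose[OF \<Omega> H \<theta>])
  have i: "integrable ?M (\<lambda>x. G x \<bullet> (\<theta>' (v x) *\<^sub>R G x))"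
    using H H\<theta> by (intro square_integrable_inner) (auto simp: H10_iff)
  have nn: "0 \<le> G x \<bullet> (\<theta>' (v x) *\<^sub>R G x)" for x using pos by simp
  have "(LINT x|?M. G x \<bullet> (\<theta>' (v x) *\<^sub>R G x)) = 0"
    using le integral_nonneg_AE[OF AE_I2, of ?M "\<lambda>x. G x \<bullet> (\<theta>' (v x) *\<^sub>R G x)", OF nn] by linarith
  then have "AE x in ?M. G x \<bullet> (\<theta>' (v x) *\<^sub>R G x) = 0"
    using integral_nonneg_eq_0_iff_AE[OF i] nn by simp
  then have "AE x in ?M. \<theta>' (v x) *\<^sub>R G x = 0" by eventually_elim auto
  then show ?thesis by (rule H10_zero_gradient[OF \<Omega> H\<theta>])
qed

text \<open>Separates the differential equation from the special nonlinearity: \<open>g\<close>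
  enters only through continuity, monotonicity, its range and its vanishing beyond \<open>L\<close>.
  The factor \<open>lam\<close> is meant to be absorbed into \<open>f\<close>.\<close>

lemma semilinear_solution_exists:
  fixes \<Omega> :: "'a::euclidean_space set" and f :: "'a \<Rightarrow> real" and g :: "real \<Rightarrow> real"
  assumes \<Omega>: "open \<Omega>" "bounded \<Omega>" and f: "integrable (lebesgue_on \<Omega>) f"
    and f0: "AE x in lebesgue_on \<Omega>. 0 \<le> f x"
    and cont: "continuous_on UNIV g" and anti: "antimono g"
    and g0: "\<And>s. 0 \<le> g s" and g1: "\<And>s. g s \<le> 1"
    and L: "0 \<le> L" and gL: "\<And>s. L \<le> s \<Longrightarrow> g s = 0"
  shows "\<exists>v G. H10 \<Omega> v G \<and> (AE x in lebesgue_on \<Omega>. 0 \<le> v x \<and> v x \<le> L) \<and>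
    (\<forall>\<phi> D. H10 \<Omega> \<phi> D \<longrightarrow> integrable (lebesgue_on \<Omega>) (\<lambda>x. f x * g (v x) * \<phi> x) \<and>
      (LINT x|lebesgue_on \<Omega>. G x \<bullet> D x) = (LINT x|lebesgue_on \<Omega>. f x * g (v x) * \<phi> x))"
proof -
  let ?M = "lebesgue_on \<Omega>"
  obtain v G where H: "H10 \<Omega> v G" and test: "\<And>\<psi> P. C1c_test \<Omega> \<psi> P \<Longrightarrow>
      (LINT x|?M. G x \<bullet> P x) = (LINT x|?M. f x * g (v x) * \<psi> x)"
    using weak_solution_on_test_functions[OF \<Omega> f f0 cont anti g0 g1 gL] by blast
  have [measurable]: "g \<in> borel_measurable borel" using cont by (rule borel_measurable_continuous_onI)
  have sq: "square_integrable ?M v" "square_integrable ?M G" using H by (auto simp: H10_iff)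
  note [measurable] = square_integrableD(1)[OF sq(1)]
  have u: "integrable ?M (\<lambda>x. f x * g (v x))"
    by (rule integrable_mult_bounded[OF f, where B = 1]) (auto simp: g0 g1)
  have u0: "AE x in ?M. 0 \<le> f x * g (v x)" using f0 by eventually_elim (simp add: g0)
  have ext: "integrable ?M (\<lambda>x. f x * g (v x) * \<phi> x)"
    "(LINT x|?M. G x \<bullet> D x) = (LINT x|?M. f x * g (v x) * \<phi> x)" if "H10 \<Omega> \<phi> D" for \<phi> D
    using weak_equation_extends[OF \<Omega> u u0 sq(2) _ that] test by blast+
  \<comment> \<open>This test function is nonpositive and nonzero only where \<open>v < 0\<close>;
    since \<open>f * g(v) >= 0\<close>, the right-hand side of the equation has the required
    sign.\<close>
  have "AE x in ?M. - pos_trunc (- v x) = 0"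
  proof (rule H10_truncation_zero[OF \<Omega> H, where \<theta> = "\<lambda>s. - pos_trunc (- s)" and \<theta>' = "\<lambda>s. pos_trunc' (- s)"])
    show d: "((\<lambda>s. - pos_trunc (- s)) has_field_derivative pos_trunc' (- s)) (at s)" for s
      by (auto intro!: derivative_eq_intros DERIV_chain2[OF pos_trunc_deriv])
    show c: "continuous_on UNIV (\<lambda>s. pos_trunc' (- s))"
      by (intro continuous_on_compose2[OF continuous_on_pos_trunc'] continuous_intros) auto
    show z: "- pos_trunc (- 0) = 0" by (simp add: pos_trunc_eq_0_iff)
    have "(LINT x|?M. G x \<bullet> (pos_trunc' (- v x) *\<^sub>R G x)) = (LINT x|?M. f x * g (v x) * (- pos_trunc (- v x)))"
      by (rule ext(2), rule H10_compose[OF \<Omega> H d c z]) (rule pos_trunc'_bounds)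
    also have "\<dots> = - (LINT x|?M. f x * g (v x) * pos_trunc (- v x))" by simp
    also have "\<dots> \<le> 0"
      using u0 by (simp, intro integral_nonneg_AE) (auto elim!: eventually_mono simp: pos_trunc_nonneg)
    finally show "(LINT x|?M. G x \<bullet> (pos_trunc' (- v x) *\<^sub>R G x)) \<le> 0" .
  qed (rule pos_trunc'_bounds)+
  \<comment> \<open>This test function lives where \<open>v > L\<close>, and there
    \<open>g(v) = 0\<close>, so the right-hand side vanishes identically. The assumption
    \<open>0 <= L\<close> makes the truncation zero at 0, which preserves the zero boundary
    values.\<close>
  moreover have "AE x in ?M. pos_trunc (v x - L) = 0"
  proof (rule H10_truncation_zero[OF \<Omega> H, where \<theta> = "\<lambda>s. pos_trunc (s - L)" and \<theta>' = "\<lambda>s. pos_trunc' (s - L)"])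
    show d: "((\<lambda>s. pos_trunc (s - L)) has_field_derivative pos_trunc' (s - L)) (at s)" for s
      using DERIV_chain2[OF pos_trunc_deriv[of "s - L"] DERIV_diff[OF DERIV_ident DERIV_const]] by simp
    show c: "continuous_on UNIV (\<lambda>s. pos_trunc' (s - L))"
      by (intro continuous_on_compose2[OF continuous_on_pos_trunc'] continuous_intros) auto
    show z: "pos_trunc (0 - L) = 0" using L by (simp add: pos_trunc_eq_0_iff)
    have "(LINT x|?M. G x \<bullet> (pos_trunc' (v x - L) *\<^sub>R G x)) = (LINT x|?M. f x * g (v x) * pos_trunc (v x - L))"
      by (rule ext(2), rule H10_compose[OF \<Omega> H d c z]) (rule pos_trunc'_bounds)
    also have "(\<lambda>x. f x * g (v x) * pos_trunc (v x - L)) = (\<lambda>x. 0)"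
    proof
      fix x
      show "f x * g (v x) * pos_trunc (v x - L) = 0"
        using gL[of "v x"] pos_trunc_eq_0_iff[of "v x - L"] by (cases "L \<le> v x") auto
    qed
    finally show "(LINT x|?M. G x \<bullet> (pos_trunc' (v x - L) *\<^sub>R G x)) \<le> 0" by simp
  qed (rule pos_trunc'_bounds)+
  ultimately have "AE x in ?M. 0 \<le> v x \<and> v x \<le> L"
    by eventually_elim (simp add: pos_trunc_eq_0_iff)
  then show ?thesis using H ext by blast
qed

text \<open>A bounded open set has finite measure, so \<open>1 + |f|^p\<close> is an integrable
  majorant of \<open>|f|\<close>.\<close>

lemma Lp_on_integrable:
  fixes \<Omega> :: "'a::euclidean_space set"
  assumes \<Omega>: "open \<Omega>" "bounded \<Omega>" and "1 \<le> p" "Lp_on \<Omega> p f"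
  shows "integrable (lebesgue_on \<Omega>) f"
proof -
  interpret finite_measure "lebesgue_on \<Omega>" by (rule finite_measure_lebesgue_on_bounded[OF \<Omega>])
  have "integrable (lebesgue_on \<Omega>) (\<lambda>x. 1 + \<bar>f x\<bar> powr p)"
    using assms(4) by (auto simp: Lp_on_def)
  then show ?thesis
  proof (rule Bochner_Integration.integrable_bound)
    show "f \<in> borel_measurable (lebesgue_on \<Omega>)" using assms(4) by (simp add: Lp_on_def)
    show "AE x in lebesgue_on \<Omega>. norm (f x) \<le> norm (1 + \<bar>f x\<bar> powr p)"
    proof (rule AE_I2)
      fix x
      have "\<bar>f x\<bar> \<le> 1 + \<bar>f x\<bar> powr p"
      proof (cases "\<bar>f x\<bar> \<le> 1")
        case True
        then show ?thesis using powr_ge_zero[of "\<bar>f x\<bar>" p] by linarith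
      next
        case False
        then show ?thesis using powr_mono[OF assms(3), of "\<bar>f x\<bar>"] by simp
      qed
      then show "norm (f x) \<le> norm (1 + \<bar>f x\<bar> powr p)" by simp
    qed
  qed
qed

theorem theorem4p3:
  fixes \<Omega> :: "'a::euclidean_space set"
    and h :: "real \<Rightarrow> real" and f :: "'a \<Rightarrow> real"
    and \<sigma> \<gamma> C p \<rho> lam :: real
  assumes "open \<Omega>" and "bounded \<Omega>"
    and "\<sigma> > 0"
    and "continuous_on {0..<\<sigma>} h"
    and "strict_mono_on {0..<\<sigma>} h"
    and "\<forall>s\<in>{0..<\<sigma>}. h s \<ge> 0"
    and "filterlim h at_top (at_left \<sigma>)"
    and "1 \<le> \<gamma>" and "\<gamma> < 2"
    and "C > 0"
    and "((\<lambda>s. (\<sigma> - s) powr \<gamma> * h s) \<longlongrightarrow> C) (at_left \<sigma>)"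
    and "p \<ge> 1" and "p > real DIM('a) / 2"
    and "Lp_on \<Omega> p f"
    and "\<rho> > 0" and "AE x in lebesgue_on \<Omega>. f x \<ge> \<rho>"
    and "lam > 0"
  shows "\<exists>v G. H10 \<Omega> v G \<and>
           (AE x in lebesgue_on \<Omega>. 0 \<le> v x \<and> v x \<le> Lval h \<sigma>) \<and>
           (\<forall>\<phi> D. H10 \<Omega> \<phi> D \<longrightarrow>
              integrable (lebesgue_on \<Omega>) (\<lambda>x. f x * gf h \<sigma> (v x) * \<phi> x) \<and>
              (LINT x|lebesgue_on \<Omega>. G x \<bullet> D x)
                = lam * (LINT x|lebesgue_on \<Omega>. f x * gf h \<sigma> (v x) * \<phi> x)) \<and>
           (\<forall>w W. H10 \<Omega> w W \<and>
              (AE x in lebesgue_on \<Omega>. 0 \<le> w x \<and> w x \<le> Lval h \<sigma>) \<and>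
              (\<forall>\<phi> D. H10 \<Omega> \<phi> D \<longrightarrow>
                 (LINT x|lebesgue_on \<Omega>. W x \<bullet> D x)
                   = lam * (LINT x|lebesgue_on \<Omega>. f x * gf h \<sigma> (w x) * \<phi> x))
              \<longrightarrow> (AE x in lebesgue_on \<Omega>. w x = v x))"
proof -
  let ?M = "lebesgue_on \<Omega>" and ?L = "Lval h \<sigma>"
  note \<Omega> = \<open>open \<Omega>\<close> \<open>bounded \<Omega>\<close>
  define g where "g s = gf h \<sigma> (max 0 s)" for s
  have Hinf: "filterlim (Hf h) at_top (at_left \<sigma>)"
    by (rule filterlim_Hf_at_top) (use assms in auto)
  note g = gf_regular[OF \<open>\<sigma> > 0\<close> \<open>continuous_on {0..<\<sigma>} h\<close> \<open>\<forall>s\<in>{0..<\<sigma>}. h s \<ge> 0\<close> Hinf, folded g_def]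
  note [measurable] = g(7)
  have fi: "integrable ?M f" by (rule Lp_on_integrable[OF \<Omega> \<open>p \<ge> 1\<close> \<open>Lp_on \<Omega> p f\<close>])
  then have [measurable]: "f \<in> borel_measurable ?M" by auto
  have f0: "AE x in ?M. 0 \<le> f x"
    using \<open>AE x in lebesgue_on \<Omega>. f x \<ge> \<rho>\<close> \<open>\<rho> > 0\<close> by (auto elim!: eventually_mono)
  have lf: "integrable ?M (\<lambda>x. lam * f x)" "AE x in ?M. 0 \<le> lam * f x"
    using fi f0 \<open>lam > 0\<close> by auto
  obtain v G where H: "H10 \<Omega> v G" and v: "AE x in ?M. 0 \<le> v x \<and> v x \<le> ?L"
    and eq: "\<And>\<phi> D. H10 \<Omega> \<phi> D \<Longrightarrow> integrable ?M (\<lambda>x. lam * f x * g (v x) * \<phi> x) \<and>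
      (LINT x|?M. G x \<bullet> D x) = (LINT x|?M. lam * f x * g (v x) * \<phi> x)"
    using semilinear_solution_exists[OF \<Omega> lf g(2-5) g(1,6)] by blast
  have meas: "u \<in> borel_measurable ?M" if "H10 \<Omega> u U" for u U
    using that by (simp add: H10_iff square_integrable_def)
  note [measurable] = meas[OF H]
  have [measurable]: "g \<in> borel_measurable borel" using g(2) by (rule borel_measurable_continuous_onI)
  have gf_eq: "gf h \<sigma> s = g s" if "0 \<le> s" for s using that by (simp add: g_def)
  have sol: "integrable ?M (\<lambda>x. f x * gf h \<sigma> (v x) * \<phi> x) \<and>
      (LINT x|?M. G x \<bullet> D x) = lam * (LINT x|?M. f x * gf h \<sigma> (v x) * \<phi> x)" if "H10 \<Omega> \<phi> D" for \<phi> D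
  proof -
    note [measurable] = meas[OF that]
    have ae: "AE x in ?M. f x * g (v x) * \<phi> x = f x * gf h \<sigma> (v x) * \<phi> x"
      using v by eventually_elim (simp add: gf_eq)
    have "integrable ?M (\<lambda>x. f x * g (v x) * \<phi> x)"
      using conjunct1[OF eq[OF that]] \<open>lam > 0\<close> by (simp add: mult.assoc)
    then have "integrable ?M (\<lambda>x. f x * gf h \<sigma> (v x) * \<phi> x)"
      by (subst integrable_cong_AE[OF _ _ ae, symmetric]) auto
    moreover have "(LINT x|?M. f x * g (v x) * \<phi> x) = (LINT x|?M. f x * gf h \<sigma> (v x) * \<phi> x)"
      by (rule integral_cong_AE[OF _ _ ae]) auto
    ultimately show ?thesis using eq[OF that] by (simp add: mult.assoc)
  qed
  have "AE x in ?M. w x = v x"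
    if Hw: "H10 \<Omega> w W" and w: "AE x in ?M. 0 \<le> w x \<and> w x \<le> ?L"
      and eqw: "\<And>\<phi> D. H10 \<Omega> \<phi> D \<Longrightarrow>
        (LINT x|?M. W x \<bullet> D x) = lam * (LINT x|?M. f x * gf h \<sigma> (w x) * \<phi> x)" for w W
  proof -
    note [measurable] = meas[OF Hw]
    have Hd: "H10 \<Omega> (\<lambda>x. v x - w x) (\<lambda>x. G x - W x)" by (rule H10_diff[OF \<Omega> H Hw])
    have sq: "square_integrable ?M G" "square_integrable ?M W" "square_integrable ?M (\<lambda>x. G x - W x)"
      using H Hw Hd by (auto simp: H10_iff)
    \<comment> \<open>The equation assumed for \<open>w\<close> does not assert integrability, and
      the integral of a non-integrable function is 0 by default, so integrals could not be
      subtracted. The bounds on \<open>v\<close> and \<open>w\<close> close this gap: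
      \<open>g <= 1\<close> and \<open>|v - w| <= ?L\<close>.\<close>
    have iw: "integrable ?M (\<lambda>x. f x * (gf h \<sigma> (w x) * (v x - w x)))"
    proof (rule integrable_mult_bounded[OF fi, where B = ?L])
      show "AE x in ?M. \<bar>gf h \<sigma> (w x) * (v x - w x)\<bar> \<le> ?L"
        using v w
      proof eventually_elim
        case (elim x)
        have "\<bar>g (w x)\<bar> * \<bar>v x - w x\<bar> \<le> 1 * ?L"
          using elim g(4,5)[of "w x"] by (intro mult_mono) auto
        then show ?case using elim by (simp add: gf_eq abs_mult)
      qed
    qed simp
    have "sq_norm ?M (\<lambda>x. G x - W x) = (LINT x|?M. G x \<bullet> (G x - W x)) - (LINT x|?M. W x \<bullet> (G x - W x))"
      unfolding sq_norm_def power2_norm_eq_inner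
      using square_integrable_inner[OF sq(1,3)] square_integrable_inner[OF sq(2,3)]
      by (subst Bochner_Integration.integral_diff[symmetric]) (auto simp: inner_diff_left)
    also have "\<dots> = lam * ((LINT x|?M. f x * gf h \<sigma> (v x) * (v x - w x)) - (LINT x|?M. f x * gf h \<sigma> (w x) * (v x - w x)))"
      using sol[OF Hd] eqw[OF Hd] by (simp add: right_diff_distrib)
    also have "\<dots> = - (lam * (LINT x|?M. f x * gf h \<sigma> (w x) * (v x - w x) - f x * gf h \<sigma> (v x) * (v x - w x)))"
      using sol[OF Hd] iw by (subst Bochner_Integration.integral_diff) (auto simp: mult.assoc algebra_simps)
    also have "\<dots> \<le> 0"
    proof -
      have "AE x in ?M. 0 \<le> f x * gf h \<sigma> (w x) * (v x - w x) - f x * gf h \<sigma> (v x) * (v x - w x)"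
        using v w f0
      proof eventually_elim
        case (elim x)
        have "(g (v x) - g (w x)) * (v x - w x) \<le> 0"
          using g(3) by (cases "v x \<le> w x") (auto simp: antimono_def mult_nonneg_nonpos mult_nonpos_nonneg)
        then have "f x * ((g (v x) - g (w x)) * (v x - w x)) \<le> 0"
          using mult_nonneg_nonpos[OF elim(3)] by blast
        then show ?case using elim by (simp add: gf_eq algebra_simps)
      qed
      then show ?thesis using \<open>lam > 0\<close> by (simp add: integral_nonneg_AE)
    qed
    finally have "sq_norm ?M (\<lambda>x. G x - W x) = 0" using sq_norm_nonneg[of ?M "\<lambda>x. G x - W x"] by simp
    then have "AE x in ?M. (norm (G x - W x))\<^sup>2 = 0"
      unfolding sq_norm_def using integral_nonneg_eq_0_iff_AE[OF square_integrableD(2)[OF sq(3)]] by simp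
    then have "AE x in ?M. G x - W x = 0" by eventually_elim simp
    from H10_zero_gradient[OF \<Omega> Hd this] show ?thesis by eventually_elim simp
  qed
  then show ?thesis using H v sol by blast
qed

end
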